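(* Consider an instance of the Sparse Combination Measure Problem (SCMP): discrete probability measures $P_1,\dots,P_m$ in $\mathbb{Q}^d$ with rational masses, a weight vector $\lambda\in\mathbb{Q}^m_+$, a support size bound $N\in\mathbb{N}$ and a transport cost bound $\Phi$, where the question is whether there exists a combination measure $P^*$ with support size at most $N$ and transport cost $\phi(P^* )\le\Phi$. Let $L$ be the largest encoding size of $P_1,\dots,P_m$. If a combination measure $P^*$ supplied as a possible solution to SCMP has an encoding size polynomial in $L$, then it can be verified efficiently, i.e. in time polynomial in the encoding size of the original input, whether $P^*$ is a solution (that is, whether $P^*$ has at most $N$ support points and $\phi(P^* )\le\Phi$).
   Context: All rational data are encoded in binary. The weight vector satisfies $\lambda_i>0$ and $\sum_{i=1}^m\lambda_i=1$. It is a standing assumption that the encoding size of the original input is dominated by the encoding of the measures $P_1,\dots,P_m$ (masses and coordinates of support points). "Encoding size polynomial in $L$" means bounded by $p(L)$ for a fixed polynomial $p$. Combination measure: let $S^*=\{(\mathbf{x}_1,\dots,\mathbf{x}_m):\mathbf{x}_i\in\mathrm{supp}(P_i)\}$. A combination measure $P^*$ for $P_1,\dots,P_m$ and $\lambda$ is a probability measure given as a finite set of tuples $s_j=(\mathbf{x}_1^j,\dots,\mathbf{x}_m^j)\in S^*$ with associated masses $w_j>0$, such that for every $i$ and every support point $\mathbf{x}$ of $P_i$ the sum of $w_j$ over all chosen tuples with $\mathbf{x}_i^j=\mathbf{x}$ equals the mass of $\mathbf{x}$ in $P_i$. Its support points are the weighted means $\mathbf{x}^j=\sum_{i=1}^m\lambda_i\mathbf{x}_i^j$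 (one for each chosen tuple) with mass $w_j$, and $\mathbf{x}^j$ transports its full mass to $\mathbf{x}_i^j$ in each $P_i$. The encoding of $P^*$ is the list of its tuples (with coordinates) and (rational) masses. The transport cost of $P^*$ is $\phi(P^* )=\sum_j c(s_j)w_j$, the sum being over the chosen tuples, where $c(s_j)=\sum_{i=1}^m\lambda_i\|\mathbf{x}^j-\mathbf{x}_i^j\|^2$ with the Euclidean norm. *)

theory Defs
  imports "HOL-Computational_Algebra.Polynomial" "HOL-Analysis.L2_Norm"
begin

section \<open>Discrete measures and combination measures\<close>

text \<open>The dimension \<open>d\<close> and the number \<open>m\<close> of measures vary from instance to instance,
  so points of \<open>\<rat>\<^sup>d\<close> are rational lists of length \<open>d\<close>. A discrete measure is the list of its
  support points with their masses.\<close>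

type_synonym point = "rat list"
type_synonym dmeasure = "(point \<times> rat) list"
type_synonym comb = "(point list \<times> rat) list"

definition supp :: "dmeasure \<Rightarrow> point set" where
  "supp P = fst ` set P"

definition discrete_prob_measure :: "nat \<Rightarrow> dmeasure \<Rightarrow> bool" where
  "discrete_prob_measure d P \<longleftrightarrow>
     distinct (map fst P) \<and>
     (\<forall>(x, u) \<in> set P. length x = d \<and> u > 0) \<and>
     sum_list (map snd P) = 1"

record scmp =
  input_measures :: "dmeasure list"
  weights :: "rat list"
  size_bound :: nat
  cost_bound :: rat

definition scmp_instance :: "nat \<Rightarrow> scmp \<Rightarrow> bool" where
  "scmp_instance d I \<longleftrightarrow>
     (\<forall>P \<in> set (input_measures I). discrete_prob_measure d P) \<and>
     length (weights I) = length (input_measures I) \<and>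
     (\<forall>l \<in> set (weights I). l > 0) \<and>
     sum_list (weights I) = 1"

definition tuples :: "dmeasure list \<Rightarrow> point list set" where
  "tuples Ps = {s. length s = length Ps \<and> (\<forall>i < length Ps. s ! i \<in> supp (Ps ! i))}"

definition combination_measure :: "dmeasure list \<Rightarrow> comb \<Rightarrow> bool" where
  "combination_measure Ps Q \<longleftrightarrow>
     distinct (map fst Q) \<and>
     (\<forall>(s, w) \<in> set Q. s \<in> tuples Ps \<and> w > 0) \<and>
     sum_list (map snd Q) = 1 \<and>
     (\<forall>i < length Ps. \<forall>(x, u) \<in> set (Ps ! i).
        sum_list (map snd (filter (\<lambda>(s, w). s ! i = x) Q)) = u)"

text \<open>Every chosen tuple contributes one support point, so two tuples with the same
  weighted mean are counted separately.\<close>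

definition support_size :: "comb \<Rightarrow> nat" where
  "support_size Q = card (fst ` set Q)"

definition weighted_mean :: "nat \<Rightarrow> rat list \<Rightarrow> point list \<Rightarrow> point" where
  "weighted_mean d lam s = map (\<lambda>k. \<Sum>i < length lam. lam ! i * s ! i ! k) [0..<d]"

definition euclidean_dist :: "nat \<Rightarrow> point \<Rightarrow> point \<Rightarrow> real" where
  "euclidean_dist d x y = L2_set (\<lambda>k. of_rat (x ! k) - of_rat (y ! k)) {..<d}"

definition tuple_cost :: "nat \<Rightarrow> rat list \<Rightarrow> point list \<Rightarrow> real" where
  "tuple_cost d lam s =
     (\<Sum>i < length lam. of_rat (lam ! i) * (euclidean_dist d (weighted_mean d lam s) (s ! i))\<^sup>2)"

definition transport_cost :: "nat \<Rightarrow> rat list \<Rightarrow> comb \<Rightarrow> real" where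
  "transport_cost d lam Q = sum_list (map (\<lambda>(s, w). tuple_cost d lam s * of_rat w) Q)"


section \<open>Binary encodings\<close>

datatype sym = Blank | Zero | One | Open | Close

text \<open>Numbers are written least significant bit first, without trailing zeros.\<close>

fun bits :: "nat \<Rightarrow> sym list" where
  "bits n = (if n = 0 then [] else (if odd n then One else Zero) # bits (n div 2))"

declare bits.simps [simp del]

definition enc_nat :: "nat \<Rightarrow> sym list" where
  "enc_nat n = Open # bits n @ [Close]"

definition enc_int :: "int \<Rightarrow> sym list" where
  "enc_int z = Open # (if z < 0 then One else Zero) # bits (nat \<bar>z\<bar>) @ [Close]"

definition enc_rat :: "rat \<Rightarrow> sym list" where
  "enc_rat x = (case quotient_of x of (a, b) \<Rightarrow> enc_int a @ enc_nat (nat b))"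

definition enc_list :: "('a \<Rightarrow> sym list) \<Rightarrow> 'a list \<Rightarrow> sym list" where
  "enc_list e xs = Open # concat (map e xs) @ [Close]"

definition enc_point :: "point \<Rightarrow> sym list" where
  "enc_point = enc_list enc_rat"

definition enc_measure :: "dmeasure \<Rightarrow> sym list" where
  "enc_measure = enc_list (\<lambda>(x, u). enc_point x @ enc_rat u)"

definition enc_instance :: "scmp \<Rightarrow> sym list" where
  "enc_instance I =
     enc_list enc_measure (input_measures I) @ enc_list enc_rat (weights I) @
     enc_nat (size_bound I) @ enc_rat (cost_bound I)"

definition enc_comb :: "comb \<Rightarrow> sym list" where
  "enc_comb = enc_list (\<lambda>(s, w). enc_list enc_point s @ enc_rat w)"

definition max_measure_size :: "scmp \<Rightarrow> nat" where
  "max_measure_size I = Max ((\<lambda>P. length (enc_measure P)) ` set (input_measures I))"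

definition total_measure_size :: "scmp \<Rightarrow> nat" where
  "total_measure_size I = sum_list (map (\<lambda>P. length (enc_measure P)) (input_measures I))"


section \<open>Deterministic multi-tape Turing machines\<close>

datatype move = MoveLeft | Stay | MoveRight

fun offset :: "move \<Rightarrow> int" where
  "offset MoveLeft = -1"
| "offset Stay = 0"
| "offset MoveRight = 1"

text \<open>A tape is a two-way infinite sequence of cells together with the head position.\<close>

type_synonym tape = "(int \<Rightarrow> sym) \<times> int"

text \<open>The states are the numbers below \<open>num_states\<close>. The transition function maps a state
  and the symbols under the heads to the next state and, for each tape, the symbol to write
  and the direction in which to move.\<close>

record tm =
  num_tapes :: nat
  num_states :: nat
  start_state :: nat
  accept_state :: nat
  reject_state :: nat
  delta :: "nat \<Rightarrow> sym list \<Rightarrow> nat \<times> (sym \<times> move) list"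

definition wf_tm :: "tm \<Rightarrow> bool" where
  "wf_tm M \<longleftrightarrow>
     num_tapes M \<ge> 1 \<and>
     start_state M < num_states M \<and> accept_state M < num_states M \<and>
     reject_state M < num_states M \<and> accept_state M \<noteq> reject_state M \<and>
     (\<forall>q < num_states M. \<forall>xs. length xs = num_tapes M \<longrightarrow>
        fst (delta M q xs) < num_states M \<and> length (snd (delta M q xs)) = num_tapes M)"

fun read_tape :: "tape \<Rightarrow> sym" where
  "read_tape (t, h) = t h"

fun act :: "sym \<times> move \<Rightarrow> tape \<Rightarrow> tape" where
  "act (a, mv) (t, h) = (t(h := a), h + offset mv)"

fun step :: "tm \<Rightarrow> nat \<times> tape list \<Rightarrow> nat \<times> tape list" where
  "step M (q, ts) =
     (if q = accept_state M \<or> q = reject_state M then (q, ts)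
      else case delta M q (map read_tape ts) of (q', as) \<Rightarrow> (q', map2 act as ts))"

definition input_tape :: "sym list \<Rightarrow> tape" where
  "input_tape w = (\<lambda>j. if 0 \<le> j \<and> j < int (length w) then w ! nat j else Blank, 0)"

definition initial_config :: "tm \<Rightarrow> sym list \<Rightarrow> nat \<times> tape list" where
  "initial_config M w =
     (start_state M, input_tape w # replicate (num_tapes M - 1) (input_tape []))"

text \<open>On input \<open>w\<close> the machine halts after at most \<open>t\<close> steps and accepts iff \<open>b\<close> holds.
  The halting states are absorbing in \<^const>\<open>step\<close>, so the verdict is unique.\<close>

definition decides_within :: "tm \<Rightarrow> sym list \<Rightarrow> nat \<Rightarrow> bool \<Rightarrow> bool" where
  "decides_within M w t b \<longleftrightarrow>
     (\<exists>n \<le> t. fst ((step M ^^ n) (initial_config M w)) =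
        (if b then accept_state M else reject_state M))"

end

theory Submission
  imports Defs
begin

text \<open>
  Stacks of symbols are kept on the tapes, with the head on the top symbol, and a small while
  language over stacks is run directly by a Turing machine whose states are the finitely many
  residual programs. For types with a self-delimiting encoding, the functions computed by such
  programs in polynomial time are closed under composition, pairing, case distinction, list
  operations, and folds whose intermediate results stay polynomially small. Since pairs are encoded
  by concatenation, the input of the verifier is the encoding of the tuple of its components.

  The number of tuples of a combination measure is its support size, so it remains to compare costs.
  As the weights sum to one, twice the cost of a tuple is
  \<open>\<Sum>\<^sub>i\<^sub>,\<^sub>j \<lambda>\<^sub>i \<lambda>\<^sub>j \<parallel>x\<^sub>i - x\<^sub>j\<parallel>\<^sup>2\<close>. All sums are evaluated with unreduced fractions, whose bit length grows only
  additively with every summand.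
\<close>

text \<open>Two obstacles shape the development. A polynomial-time step that is iterated may double
  its state each time, so closure under folds needs a growth bound per item that does not depend on
  the accumulator. For sums of fractions the encoding length is the wrong measure of growth: all
  three components of a fraction may take up the size of its longest one. The fold rule therefore
  speaks of a size \<mu> that only has to agree with the encoding length up to a polynomial.

  The cost formula is chosen to suit this. Squared norms remove the root, the sum over pairs needs
  only products and sums of input rationals, and its factor 2 is never divided out: the result is
  compared with twice the cost bound.

  That the supplied \<open>Q\<close> is a combination measure is a promise to the machine, not
  something it tests. The promise fixes the shape of the tuples and makes them distinct. The bound
  on the size of \<open>Q\<close> affects only the running time, since it turns a time polynomial in
  the whole input into one polynomial in the instance.\<close>

declare fun_upd_apply [simp del]
declare fun_upd_same [simp] fun_upd_other [simp]

section \<open>A while language on the tapes of a Turing machine\<close>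

text \<open>A machine step writes first and moves afterwards, so pushing takes two steps: move to a
  new cell, then fill it. \<open>Write\<close> and \<open>Write_Top\<close> are these second halves
  and occur only as residuals of \<open>Push\<close> and \<open>Dup\<close>.\<close>

datatype com =
    Skip
  | Halt bool
  | Push nat sym
  | Write nat sym
  | Dup nat nat
  | Write_Top nat nat
  | Pop nat
  | Seq com com (infixr ";;" 60)
  | Cond nat "sym set" com com
  | Loop nat "sym set" com

section \<open>Small-step semantics and residual programs\<close>

fun stack_bound :: "com \<Rightarrow> nat" where
  "stack_bound Skip = 0"
| "stack_bound (Halt b) = 0"
| "stack_bound (Push i a) = Suc i"
| "stack_bound (Write i a) = Suc i"
| "stack_bound (Dup i j) = Suc (max i j)"
| "stack_bound (Write_Top i j) = Suc (max i j)"
| "stack_bound (Pop i) = Suc i"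
| "stack_bound (c ;; d) = max (stack_bound c) (stack_bound d)"
| "stack_bound (Cond i S c d) = max (Suc i) (max (stack_bound c) (stack_bound d))"
| "stack_bound (Loop i S c) = max (Suc i) (stack_bound c)"

definition keep :: "sym list \<Rightarrow> (sym \<times> move) list" where
  "keep rs = map (\<lambda>a. (a, Stay)) rs"

text \<open>The step sees nothing but the symbols under the heads, which is what makes it usable as
  a transition function. \<open>Skip\<close> and \<open>Halt\<close> stay where they are, and
  discarding a leading \<open>Skip\<close> costs a step of its own.\<close>

fun small :: "com \<Rightarrow> sym list \<Rightarrow> com \<times> (sym \<times> move) list" where
  "small Skip rs = (Skip, keep rs)"
| "small (Halt b) rs = (Halt b, keep rs)"
| "small (Push i a) rs = (Write i a, (keep rs)[i := (rs ! i, MoveLeft)])"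
| "small (Write i a) rs = (Skip, (keep rs)[i := (a, Stay)])"
| "small (Dup i j) rs = (Write_Top i j, (keep rs)[j := (rs ! j, MoveLeft)])"
| "small (Write_Top i j) rs = (Skip, (keep rs)[j := (rs ! i, Stay)])"
| "small (Pop i) rs = (Skip, (keep rs)[i := (rs ! i, MoveRight)])"
| "small (c ;; d) rs =
     (if c = Skip then (d, keep rs) else (fst (small c rs) ;; d, snd (small c rs)))"
| "small (Cond i S c d) rs = (if rs ! i \<in> S then c else d, keep rs)"
| "small (Loop i S c) rs = (if rs ! i \<in> S then c ;; Loop i S c else Skip, keep rs)"

text \<open>The analogue of the partial derivatives of a regular expression: unfolding a loop only
  puts a residual of its body in front of the same loop. The set is thus finite and closed under
  \<open>small\<close>.\<close>

fun residuals :: "com \<Rightarrow> com set" where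
  "residuals Skip = {Skip}"
| "residuals (Halt b) = {Halt b}"
| "residuals (Push i a) = {Push i a, Write i a, Skip}"
| "residuals (Write i a) = {Write i a, Skip}"
| "residuals (Dup i j) = {Dup i j, Write_Top i j, Skip}"
| "residuals (Write_Top i j) = {Write_Top i j, Skip}"
| "residuals (Pop i) = {Pop i, Skip}"
| "residuals (c ;; d) = (\<lambda>c'. c' ;; d) ` residuals c \<union> residuals d"
| "residuals (Cond i S c d) = {Cond i S c d} \<union> residuals c \<union> residuals d"
| "residuals (Loop i S c) = {Loop i S c, Skip} \<union> (\<lambda>c'. c' ;; Loop i S c) ` residuals c"

lemma residuals_refl: "c \<in> residuals c"
  by (induction c) auto

lemma finite_residuals: "finite (residuals c)"
  by (induction c) auto

lemma residuals_small: "c' \<in> residuals c \<Longrightarrow> fst (small c' rs) \<in> residuals c"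
proof (induction c arbitrary: c')
  case (Loop i S c)
  then consider "c' = Loop i S c" | "c' = Skip" | c1 where "c1 \<in> residuals c" "c' = c1 ;; Loop i S c"
    by auto
  then show ?case using Loop.IH by cases (auto simp: residuals_refl)
qed (auto simp: residuals_refl)

lemma length_small: "length (snd (small c rs)) = length rs"
  by (induction c) (auto simp: keep_def)

definition small_step :: "com \<times> tape list \<Rightarrow> com \<times> tape list" where
  "small_step s = (case small (fst s) (map read_tape (snd s)) of (c', as) \<Rightarrow> (c', map2 act as (snd s)))"

lemma keep_act: "map2 act (keep (map read_tape ts)) ts = ts"
proof (rule nth_equalityI)
  fix i assume "i < length (map2 act (keep (map read_tape ts)) ts)"
  then show "map2 act (keep (map read_tape ts)) ts ! i = ts ! i"
    by (cases "ts ! i") (auto simp: keep_def)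
qed (simp add: keep_def)

lemma keep_update_act:
  "i < length ts \<Longrightarrow>
   map2 act ((keep (map read_tape ts))[i := p]) ts = ts[i := act p (ts ! i)]"
proof (rule nth_equalityI)
  fix j assume "i < length ts" "j < length (map2 act ((keep (map read_tape ts))[i := p]) ts)"
  then show "map2 act ((keep (map read_tape ts))[i := p]) ts ! j = ts[i := act p (ts ! i)] ! j"
    by (cases "ts ! j") (auto simp: keep_def nth_list_update)
qed (simp add: keep_def)

lemma small_step_simps:
  "small_step (Skip, ts) = (Skip, ts)"
  "small_step (Halt b, ts) = (Halt b, ts)"
  "i < length ts \<Longrightarrow> small_step (Push i a, ts) = (Write i a, ts[i := act (read_tape (ts ! i), MoveLeft) (ts ! i)])"
  "i < length ts \<Longrightarrow> small_step (Write i a, ts) = (Skip, ts[i := act (a, Stay) (ts ! i)])"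
  "i < length ts \<Longrightarrow> j < length ts \<Longrightarrow>
     small_step (Dup i j, ts) = (Write_Top i j, ts[j := act (read_tape (ts ! j), MoveLeft) (ts ! j)])"
  "i < length ts \<Longrightarrow> j < length ts \<Longrightarrow>
     small_step (Write_Top i j, ts) = (Skip, ts[j := act (read_tape (ts ! i), Stay) (ts ! j)])"
  "i < length ts \<Longrightarrow> small_step (Pop i, ts) = (Skip, ts[i := act (read_tape (ts ! i), MoveRight) (ts ! i)])"
  "small_step (Skip ;; d, ts) = (d, ts)"
  "c \<noteq> Skip \<Longrightarrow> small_step (c ;; d, ts) = (fst (small_step (c, ts)) ;; d, snd (small_step (c, ts)))"
  "i < length ts \<Longrightarrow> small_step (Cond i S c d, ts) = (if read_tape (ts ! i) \<in> S then c else d, ts)"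
  "i < length ts \<Longrightarrow> small_step (Loop i S c, ts) = (if read_tape (ts ! i) \<in> S then c ;; Loop i S c else Skip, ts)"
  by (simp_all add: small_step_def keep_act keep_update_act split: prod.splits)

text \<open>Only an inequality, because \<open>c\<close> may reach \<open>Skip\<close> early and
  idle there for the rest of the \<open>n\<close> steps. The additional step discards
  \<open>Skip\<close>.\<close>

lemma seq_small_steps:
  "(small_step ^^ n) (c, ts) = (Skip, ts') \<Longrightarrow> \<exists>m \<le> n + 1. (small_step ^^ m) (c ;; d, ts) = (d, ts')"
proof (induction n arbitrary: c ts)
  case 0
  then show ?case by (auto intro!: exI[of _ 1] simp: small_step_simps)
next
  case (Suc n)
  show ?case
  proof (cases "c = Skip")
    case True
    have "(small_step ^^ k) (Skip, ts) = (Skip, ts)" for k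
      by (induction k) (auto simp: small_step_simps)
    then have "ts = ts'" using Suc.prems True by (metis prod.inject)
    then show ?thesis using True by (auto intro!: exI[of _ 1] simp: small_step_simps)
  next
    case False
    obtain c1 ts1 where s: "small_step (c, ts) = (c1, ts1)" by fastforce
    have "(small_step ^^ n) (c1, ts1) = (Skip, ts')"
      using Suc.prems s by (simp add: funpow_Suc_right del: funpow.simps)
    from Suc.IH[OF this] obtain m where m: "m \<le> n + 1" "(small_step ^^ m) (c1 ;; d, ts1) = (d, ts')" by blast
    then have "(small_step ^^ Suc m) (c ;; d, ts) = (d, ts')"
      using False s by (simp add: funpow_Suc_right small_step_simps del: funpow.simps)
    then show ?thesis using m(1) by (intro exI[of _ "Suc m"]) auto
  qed
qed

text \<open>The cells to the left of the head are garbage.\<close>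

definition holds :: "tape \<Rightarrow> sym list \<Rightarrow> bool" where
  "holds tp xs \<longleftrightarrow> (\<forall>j. fst tp (snd tp + int j) = (if j < length xs then xs ! j else Blank))"

definition stack_top :: "sym list \<Rightarrow> sym" where
  "stack_top xs = (case xs of [] \<Rightarrow> Blank | a # _ \<Rightarrow> a)"

lemma stack_top_simps [simp]: "stack_top [] = Blank" "stack_top (a # xs) = a"
  by (simp_all add: stack_top_def)

lemma holds_top: "holds tp xs \<Longrightarrow> read_tape tp = stack_top xs"
  by (cases tp) (auto simp: holds_def stack_top_def split: list.splits dest: spec[of _ 0])

text \<open>The head moves onto a cell with arbitrary content, but the second step overwrites it
  before anything reads it.\<close>

lemma holds_push:
  "holds tp xs \<Longrightarrow> holds (act (a, Stay) (act (read_tape tp, MoveLeft) tp)) (a # xs)"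
proof (cases tp)
  case (Pair t h)
  assume tp: "holds tp xs"
  show ?thesis unfolding holds_def
  proof
    fix j
    have "t (h + int k) = (if k < length xs then xs ! k else Blank)" for k
      using tp Pair by (auto simp: holds_def)
    note this[of "j - 1"]
    moreover have "h - 1 + int j = h + int (j - 1)" if "j \<noteq> 0" using that by (cases j) auto
    ultimately show "fst (act (a, Stay) (act (read_tape tp, MoveLeft) tp)) (snd (act (a, Stay) (act (read_tape tp, MoveLeft) tp)) + int j) =
       (if j < length (a # xs) then (a # xs) ! j else Blank)"
      using tp Pair by (cases j) (auto simp: holds_def dest: spec[of _ 0])
  qed
qed

text \<open>The symbol \<open>b\<close> left behind is arbitrary, as its cell becomes garbage. The
  empty stack is covered too: beyond its top there are only blanks.\<close>

lemma holds_pop: "holds tp xs \<Longrightarrow> holds (act (b, MoveRight) tp) (tl xs)"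
proof (cases tp)
  case (Pair t h)
  assume tp: "holds tp xs"
  show ?thesis unfolding holds_def
  proof
    fix j
    have "t (h + int (Suc j)) = (if Suc j < length xs then xs ! Suc j else Blank)"
      using tp Pair unfolding holds_def by (metis fst_conv snd_conv)
    then show "fst (act (b, MoveRight) tp) (snd (act (b, MoveRight) tp) + int j) =
       (if j < length (tl xs) then tl xs ! j else Blank)"
      using Pair by (auto simp: nth_tl algebra_simps)
  qed
qed

section \<open>Big-step semantics with running times\<close>

type_synonym stacks = "nat \<Rightarrow> sym list"

text \<open>The times are the step counts of \<open>small_step\<close>; the extra 1 for a sequence
  pays for discarding \<open>Skip\<close>. \<open>Dup\<close> asks for two different stacks, since
  otherwise its second step would read the garbage cell onto which the head has just moved.\<close>

inductive exec :: "com \<Rightarrow> stacks \<Rightarrow> nat \<Rightarrow> stacks \<Rightarrow> bool" where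
  exec_Skip: "exec Skip \<sigma> 0 \<sigma>"
| exec_Push: "exec (Push i a) \<sigma> 2 (\<sigma>(i := a # \<sigma> i))"
| exec_Dup: "i \<noteq> j \<Longrightarrow> exec (Dup i j) \<sigma> 2 (\<sigma>(j := stack_top (\<sigma> i) # \<sigma> j))"
| exec_Pop: "exec (Pop i) \<sigma> 1 (\<sigma>(i := tl (\<sigma> i)))"
| exec_Seq: "exec c \<sigma> t \<sigma>' \<Longrightarrow> exec d \<sigma>' u \<sigma>'' \<Longrightarrow> exec (c ;; d) \<sigma> (t + u + 1) \<sigma>''"
| exec_Cond_True: "stack_top (\<sigma> i) \<in> S \<Longrightarrow> exec c \<sigma> t \<sigma>' \<Longrightarrow> exec (Cond i S c d) \<sigma> (t + 1) \<sigma>'"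
| exec_Cond_False: "stack_top (\<sigma> i) \<notin> S \<Longrightarrow> exec d \<sigma> t \<sigma>' \<Longrightarrow> exec (Cond i S c d) \<sigma> (t + 1) \<sigma>'"
| exec_Loop_True: "stack_top (\<sigma> i) \<in> S \<Longrightarrow> exec (c ;; Loop i S c) \<sigma> t \<sigma>' \<Longrightarrow> exec (Loop i S c) \<sigma> (t + 1) \<sigma>'"
| exec_Loop_False: "stack_top (\<sigma> i) \<notin> S \<Longrightarrow> exec (Loop i S c) \<sigma> 1 \<sigma>"

definition hold_all :: "tape list \<Rightarrow> stacks \<Rightarrow> bool" where
  "hold_all ts \<sigma> \<longleftrightarrow> (\<forall>i < length ts. holds (ts ! i) (\<sigma> i))"

lemma hold_all_update:
  "hold_all ts \<sigma> \<Longrightarrow> holds tp xs \<Longrightarrow> hold_all (ts[i := tp]) (\<sigma>(i := xs))"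
  by (auto simp: hold_all_def nth_list_update fun_upd_apply)

lemma exec_small_steps:
  "exec c \<sigma> t \<sigma>' \<Longrightarrow> hold_all ts \<sigma> \<Longrightarrow> stack_bound c \<le> length ts \<Longrightarrow>
   \<exists>n \<le> t. \<exists>ts'. (small_step ^^ n) (c, ts) = (Skip, ts') \<and> hold_all ts' \<sigma>' \<and> length ts' = length ts"
proof (induction arbitrary: ts rule: exec.induct)
  case (exec_Skip \<sigma>)
  then show ?case by auto
next
  case (exec_Push i a \<sigma>)
  then have "holds (ts ! i) (\<sigma> i)" by (auto simp: hold_all_def)
  from hold_all_update[OF exec_Push(1) holds_push[OF this]] exec_Push show ?case
    by (intro exI[of _ 2] conjI exI[of _ "ts[i := act (a, Stay) (act (read_tape (ts ! i), MoveLeft) (ts ! i))]"])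
      (simp_all add: numeral_2_eq_2 small_step_simps)
next
  case (exec_Dup i j \<sigma>)
  then have "holds (ts ! j) (\<sigma> j)" "read_tape (ts ! i) = stack_top (\<sigma> i)"
    by (auto simp: hold_all_def intro!: holds_top)
  from hold_all_update[OF exec_Dup(2) holds_push[OF this(1)]] this(2) exec_Dup show ?case
    by (intro exI[of _ 2] conjI exI[of _ "ts[j := act (stack_top (\<sigma> i), Stay) (act (read_tape (ts ! j), MoveLeft) (ts ! j))]"])
      (simp_all add: numeral_2_eq_2 small_step_simps)
next
  case (exec_Pop i \<sigma>)
  then have "holds (ts ! i) (\<sigma> i)" by (auto simp: hold_all_def)
  from hold_all_update[OF exec_Pop(1) holds_pop[OF this]] exec_Pop show ?case
    by (intro exI[of _ 1] conjI exI[of _ "ts[i := act (read_tape (ts ! i), MoveRight) (ts ! i)]"])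
      (simp_all add: small_step_simps)
next
  case (exec_Seq c \<sigma> t \<sigma>' d u \<sigma>'')
  then have b: "stack_bound c \<le> length ts" "stack_bound d \<le> length ts" by auto
  from exec_Seq.IH(1)[OF exec_Seq.prems(1) b(1)] obtain n1 ts1 where
    1: "n1 \<le> t" "(small_step ^^ n1) (c, ts) = (Skip, ts1)" "hold_all ts1 \<sigma>'" "length ts1 = length ts" by blast
  from exec_Seq.IH(2)[OF 1(3)] b 1(4) obtain n2 ts2 where
    2: "n2 \<le> u" "(small_step ^^ n2) (d, ts1) = (Skip, ts2)" "hold_all ts2 \<sigma>''" "length ts2 = length ts" by auto
  from seq_small_steps[OF 1(2)] obtain m where m: "m \<le> n1 + 1" "(small_step ^^ m) (c ;; d, ts) = (d, ts1)" by blast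
  have "(small_step ^^ (n2 + m)) (c ;; d, ts) = (Skip, ts2)"
    using m 2 by (simp add: funpow_add)
  with 1 2 m show ?case by (intro exI[of _ "n2 + m"]) auto
next
  case (exec_Cond_True \<sigma> i S c t \<sigma>' d)
  then obtain n ts' where n: "n \<le> t" "(small_step ^^ n) (c, ts) = (Skip, ts')" "hold_all ts' \<sigma>'" "length ts' = length ts"
    by fastforce
  have "read_tape (ts ! i) = stack_top (\<sigma> i)" using exec_Cond_True by (auto simp: hold_all_def intro!: holds_top)
  then have "(small_step ^^ Suc n) (Cond i S c d, ts) = (Skip, ts')"
    using n exec_Cond_True by (simp add: funpow_Suc_right small_step_simps del: funpow.simps)
  with n show ?case by (intro exI[of _ "Suc n"]) auto
next
  case (exec_Cond_False \<sigma> i S d t \<sigma>' c)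
  then obtain n ts' where n: "n \<le> t" "(small_step ^^ n) (d, ts) = (Skip, ts')" "hold_all ts' \<sigma>'" "length ts' = length ts"
    by fastforce
  have "read_tape (ts ! i) = stack_top (\<sigma> i)" using exec_Cond_False by (auto simp: hold_all_def intro!: holds_top)
  then have "(small_step ^^ Suc n) (Cond i S c d, ts) = (Skip, ts')"
    using n exec_Cond_False by (simp add: funpow_Suc_right small_step_simps del: funpow.simps)
  with n show ?case by (intro exI[of _ "Suc n"]) auto
next
  case (exec_Loop_True \<sigma> i S c t \<sigma>')
  then obtain n ts' where n: "n \<le> t" "(small_step ^^ n) (c ;; Loop i S c, ts) = (Skip, ts')"
    "hold_all ts' \<sigma>'" "length ts' = length ts"
    by fastforce
  have "read_tape (ts ! i) = stack_top (\<sigma> i)" using exec_Loop_True by (auto simp: hold_all_def intro!: holds_top)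
  then have "(small_step ^^ Suc n) (Loop i S c, ts) = (Skip, ts')"
    using n exec_Loop_True by (simp add: funpow_Suc_right small_step_simps del: funpow.simps)
  with n show ?case by (intro exI[of _ "Suc n"]) auto
next
  case (exec_Loop_False \<sigma> i S c)
  have "read_tape (ts ! i) = stack_top (\<sigma> i)" using exec_Loop_False by (auto simp: hold_all_def intro!: holds_top)
  with exec_Loop_False show ?case by (intro exI[of _ 1]) (simp add: small_step_simps)
qed

lemma machine_of_program:
  fixes c :: com
  shows "\<exists>M. wf_tm M \<and> (\<forall>w t \<sigma> b. exec c (\<lambda>i. if i = 0 then w else []) t \<sigma> \<longrightarrow>
    \<sigma> 0 = [if b then One else Zero] \<longrightarrow> decides_within M w (t + 2) b)"
proof -
  \<comment> \<open>The appended test turns the answer bit on stack 0 into a halting state. It is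
    the source of the \<open>t + 2\<close>: one step leaves the sequence and one takes the
    branch.\<close>
  define prog where "prog = c ;; Cond 0 {One} (Halt True) (Halt False)"
  define R where "R = residuals prog"
  \<comment> \<open>The successor guarantees that tape 0 exists even if \<open>c\<close> touches no
    stack.\<close>
  define K where "K = Suc (stack_bound c)"
  obtain f where f: "bij_betw f R {..<card R}"
    using ex_bij_betw_finite_nat[of R] by (auto simp: R_def finite_residuals atLeast0LessThan)
  define g where "g = inv_into R f"
  have gf: "g (f x) = x" if "x \<in> R" for x
    using f that by (simp add: g_def bij_betw_inv_into_left)
  have fR: "f x < card R" if "x \<in> R" for x
    using f that by (auto simp: bij_betw_def)
  have gR: "g q \<in> R" if "q < card R" for q
    using f that by (metis bij_betw_def g_def inv_into_into lessThan_iff)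
  have halts: "Halt True \<in> R" "Halt False \<in> R" "prog \<in> R"
    by (auto simp: R_def prog_def residuals_refl)
  define M where "M = \<lparr>num_tapes = K, num_states = card R, start_state = f prog,
     accept_state = f (Halt True), reject_state = f (Halt False),
     delta = (\<lambda>q rs. (f (fst (small (g q) rs)), snd (small (g q) rs)))\<rparr>"
  have ne: "f (Halt True) \<noteq> f (Halt False)"
    using halts gf by (metis com.inject(1))
  have wf: "wf_tm M"
    using ne halts fR gR residuals_small[of _ prog]
    by (auto simp: wf_tm_def M_def K_def length_small R_def)
  have step1: "step M (f x, ts) = (f (fst (small_step (x, ts))), snd (small_step (x, ts))) \<and>
      fst (small_step (x, ts)) \<in> R" if "x \<in> R" for x ts
  proof -
    have "f x = f y \<longleftrightarrow> x = y" if "y \<in> R" for y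
      using that \<open>x \<in> R\<close> by (metis gf)
    then show ?thesis using halts that gf[OF that] residuals_small[of x prog "map read_tape ts"]
      by (cases "small x (map read_tape ts)") (auto simp: M_def small_step_def keep_act R_def)
  qed
  have steps: "(step M ^^ n) (f x, ts) = (f (fst ((small_step ^^ n) (x, ts))), snd ((small_step ^^ n) (x, ts))) \<and>
      fst ((small_step ^^ n) (x, ts)) \<in> R" if "x \<in> R" for x ts n
    using that
  proof (induction n)
    case (Suc n)
    then show ?case using step1[of "fst ((small_step ^^ n) (x, ts))" "snd ((small_step ^^ n) (x, ts))"] by simp
  qed simp
  show ?thesis
  proof (intro exI[of _ M] conjI allI impI wf)
    fix w t \<sigma> b
    assume ex: "exec c (\<lambda>i. if i = 0 then w else []) t \<sigma>" and out: "\<sigma> 0 = [if b then One else Zero]"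
    let ?ts = "input_tape w # replicate (K - 1) (input_tape [])"
    have "hold_all ?ts (\<lambda>i. if i = 0 then w else [])"
      by (auto simp: hold_all_def holds_def input_tape_def nth_Cons')
    from exec_small_steps[OF ex this] obtain n ts' where
      n: "n \<le> t" "(small_step ^^ n) (c, ?ts) = (Skip, ts')" "hold_all ts' \<sigma>" "length ts' = K"
      by (auto simp: K_def)
    from seq_small_steps[OF n(2)] obtain m where
      m: "m \<le> n + 1" "(small_step ^^ m) (prog, ?ts) = (Cond 0 {One} (Halt True) (Halt False), ts')"
      by (auto simp: prog_def)
    have "read_tape (ts' ! 0) = stack_top (\<sigma> 0)" using n by (auto simp: hold_all_def K_def intro!: holds_top)
    then have "(small_step ^^ Suc m) (prog, ?ts) = (Halt b, ts')"
      using m out n(4) by (simp add: small_step_simps K_def)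
    then have "fst ((step M ^^ Suc m) (initial_config M w)) = f (Halt b)"
      using steps[OF halts(3), of "Suc m" ?ts] by (simp add: initial_config_def M_def del: funpow.simps)
    then show "decides_within M w (t + 2) b"
      using m(1) n(1) unfolding decides_within_def
      by (intro exI[of _ "Suc m"]) (auto simp: M_def)
  qed
qed


section \<open>Stack programs\<close>

text \<open>Time bounds space. All size bounds for computed values, which composition needs, come
  from here.\<close>

lemma exec_growth: "exec c \<sigma> t \<sigma>' \<Longrightarrow> length (\<sigma>' i) \<le> length (\<sigma> i) + t"
  by (induction rule: exec.induct) (auto simp: fun_upd_apply)

definition runs :: "com \<Rightarrow> stacks \<Rightarrow> nat \<Rightarrow> stacks \<Rightarrow> bool" where
  "runs c \<sigma> T \<sigma>' \<longleftrightarrow> (\<exists>t \<le> T. exec c \<sigma> t \<sigma>')"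

lemma runs_mono: "runs c \<sigma> T \<sigma>' \<Longrightarrow> T \<le> U \<Longrightarrow> runs c \<sigma> U \<sigma>'"
  unfolding runs_def by (meson order_trans)

lemma runs_cong: "runs c \<sigma> T \<sigma>1 \<Longrightarrow> \<sigma>1 = \<sigma>2 \<Longrightarrow> T \<le> U \<Longrightarrow> runs c \<sigma> U \<sigma>2"
  using runs_mono by blast

lemma runs_Skip: "runs Skip \<sigma> 0 \<sigma>"
  unfolding runs_def using exec_Skip by blast

lemma runs_Push: "runs (Push i a) \<sigma> 2 (\<sigma>(i := a # \<sigma> i))"
  unfolding runs_def using exec_Push by blast

lemma runs_Dup: "i \<noteq> j \<Longrightarrow> runs (Dup i j) \<sigma> 2 (\<sigma>(j := stack_top (\<sigma> i) # \<sigma> j))"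
  unfolding runs_def using exec_Dup by blast

lemma runs_Pop: "runs (Pop i) \<sigma> 1 (\<sigma>(i := tl (\<sigma> i)))"
  unfolding runs_def using exec_Pop by blast

lemma runs_Seq: "runs c \<sigma> t \<sigma>' \<Longrightarrow> runs d \<sigma>' u \<sigma>'' \<Longrightarrow> runs (c ;; d) \<sigma> (t + u + 1) \<sigma>''"
  unfolding runs_def using exec_Seq by (metis add_le_mono order_refl)

lemma runs_Cond:
  "(stack_top (\<sigma> i) \<in> S \<Longrightarrow> runs c \<sigma> t \<sigma>') \<Longrightarrow> (stack_top (\<sigma> i) \<notin> S \<Longrightarrow> runs d \<sigma> t \<sigma>') \<Longrightarrow>
   runs (Cond i S c d) \<sigma> (t + 1) \<sigma>'"
  unfolding runs_def using exec_Cond_True exec_Cond_False by (metis add_le_mono order_refl)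

lemma runs_Loop_step:
  assumes "stack_top (\<sigma> i) \<in> S" "runs c \<sigma> t \<sigma>'" "runs (Loop i S c) \<sigma>' u \<sigma>''"
  shows "runs (Loop i S c) \<sigma> (t + u + 2) \<sigma>''"
proof -
  from runs_Seq[OF assms(2,3)] obtain v where "v \<le> t + u + 1" "exec (c ;; Loop i S c) \<sigma> v \<sigma>''"
    unfolding runs_def by blast
  with exec_Loop_True[of \<sigma> i S c v \<sigma>''] assms(1) show ?thesis
    unfolding runs_def by (intro exI[of _ "v + 1"]) auto
qed

text \<open>The premises are reordered for reasoning backwards: the run of the remaining iterations
  is known first, then the iteration before it is added.\<close>

lemma runs_Loop_unroll:
  "runs (Loop i S c) \<sigma>' u \<sigma>'' \<Longrightarrow> runs c \<sigma> t \<sigma>' \<Longrightarrow> stack_top (\<sigma> i) \<in> S \<Longrightarrow>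
   runs (Loop i S c) \<sigma> (t + u + 2) \<sigma>''"
  by (rule runs_Loop_step)

lemma runs_Loop_exit: "stack_top (\<sigma> i) \<notin> S \<Longrightarrow> runs (Loop i S c) \<sigma> 1 \<sigma>"
  unfolding runs_def using exec_Loop_False by blast

section \<open>Moving and copying stacks\<close>

definition rev_onto :: "nat \<Rightarrow> nat \<Rightarrow> com" where
  "rev_onto i j = Loop i (- {Blank}) (Dup i j ;; Pop i)"

lemma runs_rev_onto:
  assumes "i \<noteq> j" "Blank \<notin> set (\<sigma> i)"
  shows "runs (rev_onto i j) \<sigma> (6 * length (\<sigma> i) + 1) (\<sigma>(i := [], j := rev (\<sigma> i) @ \<sigma> j))"
  using assms(2)
proof (induction "\<sigma> i" arbitrary: \<sigma>)
  case Nil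
  have "\<sigma>(i := [], j := rev (\<sigma> i) @ \<sigma> j) = \<sigma>"
    using Nil(1)[symmetric] by (auto simp: fun_eq_iff fun_upd_apply)
  with runs_Loop_exit[of \<sigma> i] Nil show ?case by (simp add: rev_onto_def)
next
  case (Cons a xs)
  let ?\<tau> = "\<sigma>(i := xs, j := a # \<sigma> j)"
  have a: "\<sigma> i = a # xs" using Cons by simp
  have "runs (Dup i j ;; Pop i) \<sigma> (2 + 1 + 1) ((\<sigma>(j := stack_top (\<sigma> i) # \<sigma> j))(i := tl ((\<sigma>(j := stack_top (\<sigma> i) # \<sigma> j)) i)))"
    by (rule runs_Seq[OF runs_Dup runs_Pop]) (use assms in auto)
  also have "(\<sigma>(j := stack_top (\<sigma> i) # \<sigma> j))(i := tl ((\<sigma>(j := stack_top (\<sigma> i) # \<sigma> j)) i)) = ?\<tau>"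
    using assms(1) a by (auto simp: fun_eq_iff fun_upd_apply)
  finally have 1: "runs (Dup i j ;; Pop i) \<sigma> 4 ?\<tau>" by simp
  have "runs (rev_onto i j) ?\<tau> (6 * length (?\<tau> i) + 1) (?\<tau>(i := [], j := rev (?\<tau> i) @ ?\<tau> j))"
    by (rule Cons(1)) (use assms(1) a Cons.prems in auto)
  also have "?\<tau>(i := [], j := rev (?\<tau> i) @ ?\<tau> j) = \<sigma>(i := [], j := rev (\<sigma> i) @ \<sigma> j)"
    using assms(1) a by (auto simp: fun_eq_iff fun_upd_apply)
  finally have 2: "runs (rev_onto i j) ?\<tau> (6 * length xs + 1) (\<sigma>(i := [], j := rev (\<sigma> i) @ \<sigma> j))"
    using assms(1) by simp
  have "stack_top (\<sigma> i) \<in> - {Blank}" using a Cons.prems by auto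
  from runs_Loop_step[OF this 1 2[unfolded rev_onto_def]] show ?case
    unfolding rev_onto_def a[symmetric] by (rule runs_mono) (simp add: a)
qed

definition clear :: "nat \<Rightarrow> com" where
  "clear i = Loop i (- {Blank}) (Pop i)"

lemma runs_clear:
  assumes "Blank \<notin> set (\<sigma> i)"
  shows "runs (clear i) \<sigma> (3 * length (\<sigma> i) + 1) (\<sigma>(i := []))"
  using assms
proof (induction "\<sigma> i" arbitrary: \<sigma>)
  case Nil
  have "\<sigma>(i := []) = \<sigma>" using Nil(1)[symmetric] by (auto simp: fun_eq_iff fun_upd_apply)
  with runs_Loop_exit[of \<sigma> i] Nil show ?case by (simp add: clear_def)
next
  case (Cons a xs)
  have a: "\<sigma> i = a # xs" using Cons by simp
  have 2: "runs (clear i) (\<sigma>(i := tl (\<sigma> i))) (3 * length xs + 1) (\<sigma>(i := []))"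
    using Cons(1)[of "\<sigma>(i := xs)"] a Cons.prems by auto
  have "stack_top (\<sigma> i) \<in> - {Blank}" using a Cons.prems by auto
  from runs_Loop_step[OF this runs_Pop 2[unfolded clear_def]] show ?case
    unfolding clear_def a[symmetric] by (rule runs_mono) (simp add: a)
qed

definition move_onto :: "nat \<Rightarrow> nat \<Rightarrow> nat \<Rightarrow> com" where
  "move_onto tmp i j = rev_onto i tmp ;; rev_onto tmp j"

lemma runs_move_onto:
  assumes "i \<noteq> j" "tmp \<noteq> i" "tmp \<noteq> j" "Blank \<notin> set (\<sigma> i)" "\<sigma> tmp = []"
  shows "runs (move_onto tmp i j) \<sigma> (12 * length (\<sigma> i) + 3) (\<sigma>(i := [], j := \<sigma> i @ \<sigma> j))"
proof -
  let ?\<tau> = "\<sigma>(i := [], tmp := rev (\<sigma> i) @ \<sigma> tmp)"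
  have eq: "?\<tau>(tmp := [], j := rev (?\<tau> tmp) @ ?\<tau> j) = \<sigma>(i := [], j := \<sigma> i @ \<sigma> j)"
    using assms by (auto simp: fun_eq_iff fun_upd_apply)
  have "runs (move_onto tmp i j) \<sigma> ((6 * length (\<sigma> i) + 1) + (6 * length (?\<tau> tmp) + 1) + 1)
     (?\<tau>(tmp := [], j := rev (?\<tau> tmp) @ ?\<tau> j))"
    unfolding move_onto_def
    by (rule runs_Seq[OF runs_rev_onto runs_rev_onto]) (use assms in auto)
  then show ?thesis unfolding eq by (rule runs_mono) (use assms in simp)
qed

text \<open>Emptying the reversed copy onto both stacks restores the source while the target is
  filled.\<close>

definition copy_onto :: "nat \<Rightarrow> nat \<Rightarrow> nat \<Rightarrow> com" where
  "copy_onto tmp i j = rev_onto i tmp ;; Loop tmp (- {Blank}) (Dup tmp i ;; Dup tmp j ;; Pop tmp)"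

lemma runs_copy_onto:
  assumes "i \<noteq> j" "tmp \<noteq> i" "tmp \<noteq> j" "Blank \<notin> set (\<sigma> i)" "\<sigma> tmp = []"
  shows "runs (copy_onto tmp i j) \<sigma> (15 * length (\<sigma> i) + 3) (\<sigma>(j := \<sigma> i @ \<sigma> j))"
proof -
  have loop: "runs (Loop tmp (- {Blank}) (Dup tmp i ;; Dup tmp j ;; Pop tmp)) \<tau> (9 * length (\<tau> tmp) + 1)
      (\<tau>(tmp := [], i := rev (\<tau> tmp) @ \<tau> i, j := rev (\<tau> tmp) @ \<tau> j))" if "Blank \<notin> set (\<tau> tmp)" for \<tau>
    using that
  proof (induction "\<tau> tmp" arbitrary: \<tau>)
    case Nil
    have "\<tau>(tmp := [], i := rev (\<tau> tmp) @ \<tau> i, j := rev (\<tau> tmp) @ \<tau> j) = \<tau>" using Nil(1)[symmetric] by (auto simp: fun_eq_iff fun_upd_apply)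
    with runs_Loop_exit[of \<tau> tmp] Nil show ?case by simp
  next
    case (Cons a xs)
    have a: "\<tau> tmp = a # xs" using Cons by simp
    let ?\<rho> = "\<tau>(tmp := xs, i := a # \<tau> i, j := a # \<tau> j)"
    let ?\<rho>1 = "\<tau>(i := stack_top (\<tau> tmp) # \<tau> i)"
    let ?\<rho>2 = "?\<rho>1(j := stack_top (?\<rho>1 tmp) # ?\<rho>1 j)"
    let ?\<rho>3 = "?\<rho>2(tmp := tl (?\<rho>2 tmp))"
    have "runs (Dup tmp i ;; Dup tmp j ;; Pop tmp) \<tau> (2 + (2 + 1 + 1) + 1) ?\<rho>3"
      by (rule runs_Seq[OF runs_Dup runs_Seq[OF runs_Dup runs_Pop]]) (use assms in auto)
    also have "?\<rho>3 = ?\<rho>" using assms a by (auto simp: fun_eq_iff fun_upd_apply)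
    finally have 1: "runs (Dup tmp i ;; Dup tmp j ;; Pop tmp) \<tau> 7 ?\<rho>" by simp
    have "runs (Loop tmp (- {Blank}) (Dup tmp i ;; Dup tmp j ;; Pop tmp)) ?\<rho> (9 * length (?\<rho> tmp) + 1)
      (?\<rho>(tmp := [], i := rev (?\<rho> tmp) @ ?\<rho> i, j := rev (?\<rho> tmp) @ ?\<rho> j))"
      by (rule Cons(1)) (use assms a Cons.prems in auto)
    also have "?\<rho>(tmp := [], i := rev (?\<rho> tmp) @ ?\<rho> i, j := rev (?\<rho> tmp) @ ?\<rho> j) =
        \<tau>(tmp := [], i := rev (\<tau> tmp) @ \<tau> i, j := rev (\<tau> tmp) @ \<tau> j)"
      using assms a by (auto simp: fun_eq_iff fun_upd_apply)
    finally have 2: "runs (Loop tmp (- {Blank}) (Dup tmp i ;; Dup tmp j ;; Pop tmp)) ?\<rho> (9 * length xs + 1)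
       (\<tau>(tmp := [], i := rev (\<tau> tmp) @ \<tau> i, j := rev (\<tau> tmp) @ \<tau> j))"
      using assms by simp
    have "stack_top (\<tau> tmp) \<in> - {Blank}" using a Cons.prems by auto
    from runs_Loop_step[OF this 1 2] show ?case
      by (rule runs_mono) (simp add: a)
  qed
  let ?\<tau> = "\<sigma>(i := [], tmp := rev (\<sigma> i) @ \<sigma> tmp)"
  have eq: "?\<tau>(tmp := [], i := rev (?\<tau> tmp) @ ?\<tau> i, j := rev (?\<tau> tmp) @ ?\<tau> j) = \<sigma>(j := \<sigma> i @ \<sigma> j)"
    using assms by (auto simp: fun_eq_iff fun_upd_apply)
  have "runs (copy_onto tmp i j) \<sigma> ((6 * length (\<sigma> i) + 1) + (9 * length (?\<tau> tmp) + 1) + 1)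
     (?\<tau>(tmp := [], i := rev (?\<tau> tmp) @ ?\<tau> i, j := rev (?\<tau> tmp) @ ?\<tau> j))"
    unfolding copy_onto_def
    by (rule runs_Seq[OF runs_rev_onto loop]) (use assms in auto)
  then show ?thesis unfolding eq by (rule runs_mono) (use assms in simp)
qed

fun push_all :: "nat \<Rightarrow> sym list \<Rightarrow> com" where
  "push_all i [] = Skip"
| "push_all i (a # w) = push_all i w ;; Push i a"

lemma runs_push_all: "runs (push_all i w) \<sigma> (3 * length w) (\<sigma>(i := w @ \<sigma> i))"
proof (induction w)
  case Nil
  then show ?case using runs_Skip by simp
next
  case (Cons a w)
  from runs_Seq[OF Cons runs_Push[of i a]] show ?case
    unfolding push_all.simps by (rule runs_cong) simp_all
qed

section \<open>Self-delimiting words\<close>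

inductive forest :: "sym list \<Rightarrow> bool" where
  forest_Nil: "forest []"
| forest_Zero: "forest w \<Longrightarrow> forest (Zero # w)"
| forest_One: "forest w \<Longrightarrow> forest (One # w)"
| forest_Node: "forest v \<Longrightarrow> forest w \<Longrightarrow> forest (Open # v @ Close # w)"

lemma forest_append: "forest v \<Longrightarrow> forest w \<Longrightarrow> forest (v @ w)"
  by (induction rule: forest.induct) (auto intro: forest.intros)

lemma forest_not_Blank: "forest w \<Longrightarrow> Blank \<notin> set w"
  by (induction rule: forest.induct) auto

text \<open>Forests are the Dyck words with interspersed bits, and blocks are the nonempty ones that
  do not split. A block ends as soon as the count of open parentheses is back at zero, so a single
  pass finds its end without any separator.\<close>

inductive block :: "sym list \<Rightarrow> bool" where
  block_Zero: "block [Zero]"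
| block_One: "block [One]"
| block_Node: "forest v \<Longrightarrow> block (Open # v @ [Close])"

lemma block_forest: "block w \<Longrightarrow> forest w"
  by (induction rule: block.induct) (auto intro: forest.intros)

inductive blocks :: "nat \<Rightarrow> sym list \<Rightarrow> bool" where
  blocks_0: "blocks 0 []"
| blocks_Suc: "block v \<Longrightarrow> blocks n w \<Longrightarrow> blocks (Suc n) (v @ w)"

lemma blocks_append: "blocks m v \<Longrightarrow> blocks n w \<Longrightarrow> blocks (m + n) (v @ w)"
  by (induction rule: blocks.induct) (auto intro: blocks.intros)

lemma blocks_forest: "blocks n w \<Longrightarrow> forest w"
  by (induction rule: blocks.induct) (auto intro: forest.intros forest_append block_forest)

lemma blocks_single: "block w \<Longrightarrow> blocks (Suc 0) w"
  using blocks_Suc[OF _ blocks_0] by force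

text \<open>This distinguishes a further item from the \<open>Close\<close> at the end of a list, so
  loops over lists can decide by one symbol whether to go on.\<close>

lemma blocks_top: "blocks n w \<Longrightarrow> 0 < n \<Longrightarrow> stack_top (w @ r) \<in> {Zero, One, Open}"
  by (induction rule: blocks.induct) (auto elim!: block.cases)

text \<open>Stack \<open>d\<close> counts the open parentheses in unary.\<close>

definition track :: "nat \<Rightarrow> nat \<Rightarrow> nat \<Rightarrow> com" where
  "track d i j = Cond i {Open} (Push d One) (Cond i {Close} (Pop d) Skip) ;; Dup i j ;; Pop i"

text \<open>The first symbol is handled outside the loop because the counter is empty before it.
  After a single bit it is still empty and the loop ends at once.\<close>

definition take_block :: "nat \<Rightarrow> nat \<Rightarrow> nat \<Rightarrow> com" where
  "take_block d i j = track d i j ;; Loop d {One} (track d i j)"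

context
  fixes d i j :: nat
  assumes dist: "i \<noteq> j" "d \<noteq> i" "d \<noteq> j"
begin

lemma runs_track:
  assumes "\<sigma> i = a # r"
  shows "runs (track d i j) \<sigma> 9 (\<sigma>(d := (if a = Open then One # \<sigma> d else if a = Close then tl (\<sigma> d) else \<sigma> d),
    i := r, j := a # \<sigma> j))"
proof -
  let ?\<tau> = "\<sigma>(d := (if a = Open then One # \<sigma> d else if a = Close then tl (\<sigma> d) else \<sigma> d))"
  let ?\<tau>1 = "?\<tau>(j := stack_top (?\<tau> i) # ?\<tau> j)"
  let ?\<tau>2 = "?\<tau>1(i := tl (?\<tau>1 i))"
  have eq: "?\<tau>2 = \<sigma>(d := (if a = Open then One # \<sigma> d else if a = Close then tl (\<sigma> d) else \<sigma> d),
    i := r, j := a # \<sigma> j)"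
    using assms dist by (auto simp: fun_eq_iff fun_upd_apply)
  have c: "runs (Cond i {Close} (Pop d) Skip) \<sigma> 2 ?\<tau>" if "a \<noteq> Open"
  proof (rule runs_mono[OF runs_Cond[of _ _ _ _ 1]])
    show "runs Skip \<sigma> 1 ?\<tau>" if "stack_top (\<sigma> i) \<notin> {Close}"
      using that \<open>a \<noteq> Open\<close> assms runs_mono[OF runs_Skip] by auto
    show "runs (Pop d) \<sigma> 1 ?\<tau>" if "stack_top (\<sigma> i) \<in> {Close}"
      using that \<open>a \<noteq> Open\<close> assms runs_Pop[of d \<sigma>] by auto
  qed simp
  have "runs (Cond i {Open} (Push d One) (Cond i {Close} (Pop d) Skip)) \<sigma> 3 ?\<tau>"
  proof (rule runs_mono[OF runs_Cond[of _ _ _ _ 2]])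
    show "runs (Push d One) \<sigma> 2 ?\<tau>" if "stack_top (\<sigma> i) \<in> {Open}"
      using that assms runs_Push[of d One \<sigma>] by auto
  qed (use c assms in auto)
  from runs_Seq[OF this runs_Seq[OF runs_Dup[OF dist(1)] runs_Pop]]
  have "runs (track d i j) \<sigma> (3 + (2 + 1 + 1) + 1) ?\<tau>2"
    unfolding track_def .
  then show ?thesis unfolding eq by (rule runs_mono) simp
qed

lemma runs_track_bit:
  assumes "\<sigma> i = a # r" "a \<in> {Zero, One}"
  shows "runs (track d i j) \<sigma> 9 (\<sigma>(i := r, j := a # \<sigma> j))"
proof -
  have "(if a = Open then One # \<sigma> d else if a = Close then tl (\<sigma> d) else \<sigma> d) = \<sigma> d"
    using assms(2) by auto
  from runs_track[of \<sigma> a r, OF assms(1), unfolded this fun_upd_triv] show ?thesis .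
qed

text \<open>Stated with a continuation, because the loop does not stop after \<open>w\<close>: the
  run from the state behind \<open>w\<close> is given, and \<open>w\<close> is put in front of it.
  The counter starts above zero, and inside a forest it never falls below its start, so the loop
  cannot exit within \<open>w\<close>. Each symbol costs 9 steps for \<open>track\<close> and 2 for
  the loop.\<close>

lemma loop_forest:
  assumes "forest w" "\<sigma> i = w @ r" "\<sigma> d = replicate (Suc k) One"
    "runs (Loop d {One} (track d i j)) (\<sigma>(i := r, j := rev w @ \<sigma> j)) T \<sigma>'"
  shows "runs (Loop d {One} (track d i j)) \<sigma> (11 * length w + T) \<sigma>'"
  using assms
proof (induction arbitrary: \<sigma> r k T rule: forest.induct)
  case forest_Nil
  moreover have "\<sigma>(i := r, j := rev [] @ \<sigma> j) = \<sigma>" using forest_Nil by auto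
  ultimately show ?case by simp
next
  case (forest_Zero w)
  let ?\<tau> = "\<sigma>(i := w @ r, j := Zero # \<sigma> j)"
  have "runs (Loop d {One} (track d i j)) ?\<tau> (11 * length w + T) \<sigma>'"
  proof (rule forest_Zero.IH[where r = r and k = k])
    have "?\<tau>(i := r, j := rev w @ ?\<tau> j) = \<sigma>(i := r, j := rev (Zero # w) @ \<sigma> j)"
      using dist by (auto simp: fun_eq_iff fun_upd_apply)
    with forest_Zero.prems(3) show "runs (Loop d {One} (track d i j)) (?\<tau>(i := r, j := rev w @ ?\<tau> j)) T \<sigma>'" by simp
  qed (use dist forest_Zero.prems in auto)
  moreover have "runs (track d i j) \<sigma> 9 ?\<tau>" using runs_track_bit[of \<sigma> Zero "w @ r"] forest_Zero.prems by simp
  moreover have "stack_top (\<sigma> d) \<in> {One}" using forest_Zero.prems(2) by simp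
  ultimately have "runs (Loop d {One} (track d i j)) \<sigma> (9 + (11 * length w + T) + 2) \<sigma>'"
    by (rule runs_Loop_unroll)
  then show ?case by (rule runs_mono) simp
next
  case (forest_One w)
  let ?\<tau> = "\<sigma>(i := w @ r, j := One # \<sigma> j)"
  have "runs (Loop d {One} (track d i j)) ?\<tau> (11 * length w + T) \<sigma>'"
  proof (rule forest_One.IH[where r = r and k = k])
    have "?\<tau>(i := r, j := rev w @ ?\<tau> j) = \<sigma>(i := r, j := rev (One # w) @ \<sigma> j)"
      using dist by (auto simp: fun_eq_iff fun_upd_apply)
    with forest_One.prems(3) show "runs (Loop d {One} (track d i j)) (?\<tau>(i := r, j := rev w @ ?\<tau> j)) T \<sigma>'" by simp
  qed (use dist forest_One.prems in auto)
  moreover have "runs (track d i j) \<sigma> 9 ?\<tau>" using runs_track_bit[of \<sigma> One "w @ r"] forest_One.prems by simp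
  moreover have "stack_top (\<sigma> d) \<in> {One}" using forest_One.prems(2) by simp
  ultimately have "runs (Loop d {One} (track d i j)) \<sigma> (9 + (11 * length w + T) + 2) \<sigma>'"
    by (rule runs_Loop_unroll)
  then show ?case by (rule runs_mono) simp
next
  case (forest_Node v w)
  let ?\<tau> = "\<sigma>(d := One # \<sigma> d, i := v @ Close # w @ r, j := Open # \<sigma> j)"
  let ?\<tau>1 = "?\<tau>(i := Close # w @ r, j := rev v @ ?\<tau> j)"
  let ?\<tau>2 = "\<sigma>(i := w @ r, j := Close # rev v @ Open # \<sigma> j)"
  \<comment> \<open>The run is built from its end: the rest \<open>w\<close>, then the closing
    parenthesis, then the inner forest with the counter one higher, and finally the opening
    parenthesis.\<close>
  have "runs (Loop d {One} (track d i j)) ?\<tau>2 (11 * length w + T) \<sigma>'"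
  proof (rule forest_Node.IH(2)[where r = r and k = k])
    have "?\<tau>2(i := r, j := rev w @ ?\<tau>2 j) = \<sigma>(i := r, j := rev (Open # v @ Close # w) @ \<sigma> j)"
      using dist by (auto simp: fun_eq_iff fun_upd_apply)
    with forest_Node.prems(3) show "runs (Loop d {One} (track d i j)) (?\<tau>2(i := r, j := rev w @ ?\<tau>2 j)) T \<sigma>'" by simp
  qed (use dist forest_Node.prems in auto)
  moreover have "runs (track d i j) ?\<tau>1 9 ?\<tau>2"
  proof -
    have "?\<tau>1(d := tl (?\<tau>1 d), i := w @ r, j := Close # ?\<tau>1 j) = ?\<tau>2"
      using dist by (auto simp: fun_eq_iff fun_upd_apply)
    with runs_track[of ?\<tau>1 Close "w @ r"] show ?thesis using dist by simp
  qed
  moreover have "stack_top (?\<tau>1 d) \<in> {One}" using dist by simp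
  ultimately have "runs (Loop d {One} (track d i j)) ?\<tau>1 (9 + (11 * length w + T) + 2) \<sigma>'"
    by (rule runs_Loop_unroll)
  then have "runs (Loop d {One} (track d i j)) ?\<tau> (11 * length v + (9 + (11 * length w + T) + 2)) \<sigma>'"
    by (intro forest_Node.IH(1)[where k = "Suc k" and r = "Close # w @ r"]) (use dist forest_Node.prems in auto)
  moreover have "runs (track d i j) \<sigma> 9 ?\<tau>"
    using runs_track[of \<sigma> Open "v @ Close # w @ r"] forest_Node.prems by simp
  moreover have "stack_top (\<sigma> d) \<in> {One}" using forest_Node.prems(2) by simp
  ultimately have "runs (Loop d {One} (track d i j)) \<sigma>
      (9 + (11 * length v + (9 + (11 * length w + T) + 2)) + 2) \<sigma>'"
    by (rule runs_Loop_unroll)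
  then show ?case by (rule runs_mono) simp
qed

lemma runs_take_block:
  assumes "block w" "\<sigma> i = w @ r" "\<sigma> d = []"
  shows "runs (take_block d i j) \<sigma> (11 * length w + 1) (\<sigma>(i := r, j := rev w @ \<sigma> j))"
  using assms
proof cases
  case block_Zero
  then have "runs (track d i j) \<sigma> 9 (\<sigma>(i := r, j := rev w @ \<sigma> j))"
    using runs_track_bit[of \<sigma> Zero r] assms by simp
  from runs_Seq[OF this runs_Loop_exit[of _ d "{One}" "track d i j"]] show ?thesis
    unfolding take_block_def by (rule runs_mono) (use dist assms block_Zero in simp_all)
next
  case block_One
  then have "runs (track d i j) \<sigma> 9 (\<sigma>(i := r, j := rev w @ \<sigma> j))"
    using runs_track_bit[of \<sigma> One r] assms by simp
  from runs_Seq[OF this runs_Loop_exit[of _ d "{One}" "track d i j"]] show ?thesis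
    unfolding take_block_def by (rule runs_mono) (use dist assms block_One in simp_all)
next
  case (block_Node v)
  let ?\<tau> = "\<sigma>(d := [One], i := v @ Close # r, j := Open # \<sigma> j)"
  let ?\<tau>1 = "?\<tau>(i := Close # r, j := rev v @ ?\<tau> j)"
  let ?\<tau>2 = "\<sigma>(i := r, j := rev w @ \<sigma> j)"
  have 0: "runs (track d i j) \<sigma> 9 ?\<tau>"
    using runs_track[of \<sigma> Open "v @ Close # r"] assms block_Node by simp
  have 1: "runs (track d i j) ?\<tau>1 9 ?\<tau>2"
  proof -
    have "?\<tau>1(d := tl (?\<tau>1 d), i := r, j := Close # ?\<tau>1 j) = ?\<tau>2"
      using dist assms block_Node by (auto simp: fun_eq_iff fun_upd_apply)
    with runs_track[of ?\<tau>1 Close r] show ?thesis using dist by simp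
  qed
  have "runs (Loop d {One} (track d i j)) ?\<tau>1 (9 + 1 + 2) ?\<tau>2"
    by (rule runs_Loop_step[OF _ 1 runs_Loop_exit]) (use dist assms in auto)
  then have "runs (Loop d {One} (track d i j)) ?\<tau> (11 * length v + (9 + 1 + 2)) ?\<tau>2"
    by (rule loop_forest[where k = 0 and r = "Close # r" and w = v, rotated -1]) (use dist block_Node in auto)
  from runs_Seq[OF 0 this] show ?thesis
    unfolding take_block_def by (rule runs_mono) (simp add: block_Node)
qed

end

primrec take_blocks :: "nat \<Rightarrow> nat \<Rightarrow> nat \<Rightarrow> nat \<Rightarrow> com" where
  "take_blocks 0 d i j = Skip"
| "take_blocks (Suc n) d i j = take_block d i j ;; take_blocks n d i j"

lemma runs_take_blocks:
  assumes "i \<noteq> j" "d \<noteq> i" "d \<noteq> j" "blocks n w" "\<sigma> i = w @ r" "\<sigma> d = []"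
  shows "runs (take_blocks n d i j) \<sigma> (13 * length w) (\<sigma>(i := r, j := rev w @ \<sigma> j))"
  using assms(4,5,6)
proof (induction arbitrary: \<sigma> rule: blocks.induct)
  case blocks_0
  then have "\<sigma>(i := r, j := rev [] @ \<sigma> j) = \<sigma>" by auto
  then show ?case using runs_Skip by simp
next
  case (blocks_Suc v n w)
  let ?\<tau> = "\<sigma>(i := w @ r, j := rev v @ \<sigma> j)"
  have 1: "runs (take_block d i j) \<sigma> (11 * length v + 1) ?\<tau>"
    by (rule runs_take_block) (use blocks_Suc assms in auto)
  have "runs (take_blocks n d i j) ?\<tau> (13 * length w) (?\<tau>(i := r, j := rev w @ ?\<tau> j))"
    by (rule blocks_Suc.IH) (use blocks_Suc assms in auto)
  also have "?\<tau>(i := r, j := rev w @ ?\<tau> j) = \<sigma>(i := r, j := rev (v @ w) @ \<sigma> j)"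
    using assms by (auto simp: fun_eq_iff fun_upd_apply)
  finally have 2: "runs (take_blocks n d i j) ?\<tau> (13 * length w) (\<sigma>(i := r, j := rev (v @ w) @ \<sigma> j))" .
  \<comment> \<open>The overhead of 2 steps per block is charged to its symbols, which raises the
    factor from 11 to 13.\<close>
  have "v \<noteq> []" using blocks_Suc(1) by (auto elim: block.cases)
  then have "length v \<ge> 1" by (cases v) auto
  then have "11 * length v + 1 + 13 * length w + 1 \<le> 13 * length (v @ w)" by simp
  from runs_mono[OF runs_Seq[OF 1 2] this] show ?case by simp
qed


section \<open>Polynomial-time transformations of words\<close>

text \<open>Running times can be written as the expressions that the programs suggest; the rules
  below provide a polynomial without naming it.\<close>

definition poly_bounded :: "(nat \<Rightarrow> nat) \<Rightarrow> bool" where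
  "poly_bounded g \<longleftrightarrow> (\<exists>p. \<forall>n. g n \<le> poly p n)"

lemma poly_nat_mono: "m \<le> n \<Longrightarrow> poly p m \<le> poly (p :: nat poly) n"
  by (induction p) (auto intro: add_mono mult_mono)

named_theorems poly_bounded_intros

lemma poly_bounded_const [poly_bounded_intros]: "poly_bounded (\<lambda>n. c)"
  unfolding poly_bounded_def by (rule exI[of _ "[:c:]"]) simp

lemma poly_bounded_id [poly_bounded_intros]: "poly_bounded (\<lambda>n. n)"
  unfolding poly_bounded_def by (rule exI[of _ "[:0, 1:]"]) simp

lemma poly_bounded_add [poly_bounded_intros]:
  assumes "poly_bounded f" "poly_bounded g"
  shows "poly_bounded (\<lambda>n. f n + g n)"
proof -
  obtain p q where "f n \<le> poly p n" "g n \<le> poly q n" for n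
    using assms unfolding poly_bounded_def by blast
  then show ?thesis unfolding poly_bounded_def by (intro exI[of _ "p + q"]) (auto intro: add_mono)
qed

lemma poly_bounded_mult [poly_bounded_intros]:
  assumes "poly_bounded f" "poly_bounded g"
  shows "poly_bounded (\<lambda>n. f n * g n)"
proof -
  obtain p q where "f n \<le> poly p n" "g n \<le> poly q n" for n
    using assms unfolding poly_bounded_def by blast
  then show ?thesis unfolding poly_bounded_def by (intro exI[of _ "p * q"]) (auto intro: mult_mono)
qed

lemma poly_bounded_poly [poly_bounded_intros]:
  assumes "poly_bounded f"
  shows "poly_bounded (\<lambda>n. poly p (f n))"
proof -
  obtain q where "f n \<le> poly q n" for n
    using assms unfolding poly_bounded_def by blast
  then show ?thesis unfolding poly_bounded_def
    by (intro exI[of _ "pcompose p q"]) (auto simp: poly_pcompose intro: poly_nat_mono)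
qed

text \<open>Programs may use the stacks from 1 to \<open>k - 1\<close> as scratch space. Since the contents of all other
  stacks are arbitrary, no separate frame rule is needed.\<close>

definition transforms_on :: "'x set \<Rightarrow> ('x \<Rightarrow> sym list) \<Rightarrow> ('x \<Rightarrow> sym list) \<Rightarrow> bool" where
  "transforms_on X D E \<longleftrightarrow> (\<exists>c k p. \<forall>x \<sigma>. x \<in> X \<longrightarrow> \<sigma> 0 = D x \<longrightarrow> (\<forall>i. 0 < i \<and> i < k \<longrightarrow> \<sigma> i = []) \<longrightarrow>
     runs c \<sigma> (poly p (length (D x))) (\<sigma>(0 := E x)))"

text \<open>The words are indexed by an arbitrary type. Hence intermediate words that encode no
  value, such as a list encoding without its first symbol, can be treated as well.\<close>

definition transforms :: "('x \<Rightarrow> sym list) \<Rightarrow> ('x \<Rightarrow> sym list) \<Rightarrow> bool" where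
  "transforms D E \<longleftrightarrow> (\<exists>c k p. \<forall>x \<sigma>. \<sigma> 0 = D x \<longrightarrow> (\<forall>i. 0 < i \<and> i < k \<longrightarrow> \<sigma> i = []) \<longrightarrow>
     runs c \<sigma> (poly p (length (D x))) (\<sigma>(0 := E x)))"

lemma transformsI:
  assumes "poly_bounded T"
    "\<And>x \<sigma>. \<sigma> 0 = D x \<Longrightarrow> (\<And>i. 0 < i \<Longrightarrow> i < k \<Longrightarrow> \<sigma> i = []) \<Longrightarrow>
      runs c \<sigma> (T (length (D x))) (\<sigma>(0 := E x))"
  shows "transforms D E"
proof -
  obtain p where "T n \<le> poly p n" for n using assms(1) unfolding poly_bounded_def by blast
  with runs_mono[OF assms(2)] show ?thesis
    unfolding transforms_def by (intro exI[of _ c] exI[of _ k] exI[of _ p]) blast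
qed

lemma transformsE:
  assumes "transforms D E"
  obtains c k p where
    "\<And>x \<sigma>. \<sigma> 0 = D x \<Longrightarrow> (\<And>i. 0 < i \<Longrightarrow> i < k \<Longrightarrow> \<sigma> i = []) \<Longrightarrow>
       runs c \<sigma> (poly p (length (D x))) (\<sigma>(0 := E x))"
    "\<And>x. length (E x) \<le> length (D x) + poly p (length (D x))"
proof -
  obtain c k p where *: "\<And>x \<sigma>. \<sigma> 0 = D x \<Longrightarrow> (\<And>i. 0 < i \<Longrightarrow> i < k \<Longrightarrow> \<sigma> i = []) \<Longrightarrow>
       runs c \<sigma> (poly p (length (D x))) (\<sigma>(0 := E x))"
    using assms unfolding transforms_def by metis
  have "length (E x) \<le> length (D x) + poly p (length (D x))" for x
  proof -
    \<comment> \<open>With all other stacks empty the program is applicable for any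
      \<open>k\<close>, so the time bound yields a bound on the length of the result.\<close>
    let ?\<sigma> = "\<lambda>i. if i = 0 then D x else []"
    from *[of ?\<sigma> x] obtain t where "t \<le> poly p (length (D x))" "exec c ?\<sigma> t (?\<sigma>(0 := E x))"
      unfolding runs_def by auto
    from exec_growth[OF this(2), of 0] this(1) show ?thesis by simp
  qed
  with * show ?thesis by (rule that)
qed

section \<open>Closure properties of word transformations\<close>

lemma transforms_imp_on: "transforms D E \<Longrightarrow> transforms_on X D E"
  unfolding transforms_def transforms_on_def by metis

text \<open>Allows a restricted set of inputs to be parametrized by a type on which the words have a
  uniform description. Nonempty lists become pairs of head and tail in this way.\<close>

lemma transforms_on_cover:
  assumes "transforms A B" "\<And>x. x \<in> X \<Longrightarrow> \<exists>y. D x = A y \<and> E x = B y"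
  shows "transforms_on X D E"
proof -
  obtain c k p where "\<forall>y \<sigma>. \<sigma> 0 = A y \<longrightarrow> (\<forall>i. 0 < i \<and> i < k \<longrightarrow> \<sigma> i = []) \<longrightarrow>
     runs c \<sigma> (poly p (length (A y))) (\<sigma>(0 := B y))"
    using assms(1) unfolding transforms_def by blast
  then show ?thesis unfolding transforms_on_def
    by (intro exI[of _ c] exI[of _ k] exI[of _ p]) (metis assms(2))
qed

lemma transforms_reindex: "transforms D E \<Longrightarrow> transforms (\<lambda>x. D (h x)) (\<lambda>x. E (h x))"
  unfolding transforms_def by metis

lemma transforms_id: "transforms D D"
proof (rule transformsI[where T = "\<lambda>n. 0" and c = Skip and k = 0])
  fix x and \<sigma> :: stacks assume "\<sigma> 0 = D x"
  then show "runs Skip \<sigma> 0 (\<sigma>(0 := D x))" using runs_Skip[of \<sigma>] by (metis fun_upd_triv)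
qed (intro poly_bounded_intros)

lemma transforms_comp:
  assumes "transforms D E" "transforms E F"
  shows "transforms D F"
proof -
  obtain c k p where 1: "\<And>x \<sigma>. \<sigma> 0 = D x \<Longrightarrow> (\<And>i. 0 < i \<Longrightarrow> i < k \<Longrightarrow> \<sigma> i = []) \<Longrightarrow>
       runs c \<sigma> (poly p (length (D x))) (\<sigma>(0 := E x))"
    "\<And>x. length (E x) \<le> length (D x) + poly p (length (D x))"
    using transformsE[OF assms(1)] by metis
  obtain d l q where 2: "\<And>x \<sigma>. \<sigma> 0 = E x \<Longrightarrow> (\<And>i. 0 < i \<Longrightarrow> i < l \<Longrightarrow> \<sigma> i = []) \<Longrightarrow>
       runs d \<sigma> (poly q (length (E x))) (\<sigma>(0 := F x))"
    using transformsE[OF assms(2)] by metis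
  show ?thesis
  proof (rule transformsI[where c = "c ;; d" and k = "max k l" and T = "\<lambda>n. poly p n + poly q (n + poly p n) + 1"])
    show "poly_bounded (\<lambda>n. poly p n + poly q (n + poly p n) + 1)" by (intro poly_bounded_intros)
  next
    fix x and \<sigma> :: stacks assume \<sigma>: "\<sigma> 0 = D x" "\<And>i. 0 < i \<Longrightarrow> i < max k l \<Longrightarrow> \<sigma> i = []"
    have a: "runs c \<sigma> (poly p (length (D x))) (\<sigma>(0 := E x))" by (rule 1) (use \<sigma> in auto)
    have b: "runs d (\<sigma>(0 := E x)) (poly q (length (D x) + poly p (length (D x)))) (\<sigma>(0 := F x))"
      by (rule runs_cong[OF 2[of _ x]]) (use \<sigma> 1(2)[of x] in \<open>auto intro: poly_nat_mono\<close>)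
    from runs_Seq[OF a b]
    show "runs (c ;; d) \<sigma> (poly p (length (D x)) + poly q (length (D x) + poly p (length (D x))) + 1) (\<sigma>(0 := F x))"
      by simp
  qed
qed

lemma transforms_const:
  assumes "\<And>x. Blank \<notin> set (D x)"
  shows "transforms D (\<lambda>x. w)"
proof (rule transformsI[where c = "clear 0 ;; push_all 0 w" and k = 0 and T = "\<lambda>n. 3 * n + 1 + 3 * length w + 1"])
  show "poly_bounded (\<lambda>n. 3 * n + 1 + 3 * length w + 1)" by (intro poly_bounded_intros)
next
  fix x and \<sigma> :: stacks assume "\<sigma> 0 = D x"
  then show "runs (clear 0 ;; push_all 0 w) \<sigma> (3 * length (D x) + 1 + 3 * length w + 1) (\<sigma>(0 := w))"
    using assms[of x] runs_clear[of \<sigma> 0]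
    by (intro runs_cong[OF runs_Seq[OF _ runs_push_all]]) auto
qed

lemma transforms_append:
  assumes "transforms D E" "transforms D F" "\<And>x. Blank \<notin> set (D x)" "\<And>x. Blank \<notin> set (E x)"
  shows "transforms D (\<lambda>x. E x @ F x)"
proof -
  obtain c k p where 1: "\<And>x \<sigma>. \<sigma> 0 = D x \<Longrightarrow> (\<And>i. 0 < i \<Longrightarrow> i < k \<Longrightarrow> \<sigma> i = []) \<Longrightarrow>
       runs c \<sigma> (poly p (length (D x))) (\<sigma>(0 := E x))"
    "\<And>x. length (E x) \<le> length (D x) + poly p (length (D x))"
    using transformsE[OF assms(1)] by metis
  obtain d l q where 2: "\<And>x \<sigma>. \<sigma> 0 = D x \<Longrightarrow> (\<And>i. 0 < i \<Longrightarrow> i < l \<Longrightarrow> \<sigma> i = []) \<Longrightarrow>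
       runs d \<sigma> (poly q (length (D x))) (\<sigma>(0 := F x))"
    using transformsE[OF assms(2)] by metis
  \<comment> \<open>Stacks from \<open>K\<close> on lie beyond the scratch space of both programs.
    Stack \<open>K\<close> keeps the input, \<open>K + 1\<close> keeps the first result, and
    \<open>K + 2\<close> serves the copying.\<close>
  define K where "K = Suc (max k l)"
  have K: "0 < K" "k < K" "l < K" by (auto simp: K_def)
  let ?c = "copy_onto (K + 2) 0 K ;; c ;; move_onto (K + 2) 0 (K + 1) ;; move_onto (K + 2) K 0 ;; d ;;
    move_onto (K + 2) (K + 1) 0"
  let ?T = "\<lambda>n. (15 * n + 3) + (poly p n + ((12 * (n + poly p n) + 3) + ((12 * n + 3) + (poly q n +
    (12 * (n + poly p n) + 3) + 1) + 1) + 1) + 1) + 1"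
  show ?thesis
  proof (rule transformsI[where c = ?c and k = "K + 3" and T = ?T])
    show "poly_bounded ?T" by (intro poly_bounded_intros)
  next
    fix x and \<sigma> :: stacks assume \<sigma>: "\<sigma> 0 = D x" "\<And>i. 0 < i \<Longrightarrow> i < K + 3 \<Longrightarrow> \<sigma> i = []"
    have e: "\<sigma> K = []" "\<sigma> (K + 1) = []" "\<sigma> (K + 2) = []" using \<sigma> K by auto
    let ?n = "length (D x)"
    have s1: "runs (copy_onto (K + 2) 0 K) \<sigma> (15 * ?n + 3) (\<sigma>(K := D x))"
      using K e \<sigma>(1) assms by (intro runs_cong[OF runs_copy_onto]) auto
    have s2: "runs c (\<sigma>(K := D x)) (poly p ?n) (\<sigma>(0 := E x, K := D x))"
      by (rule runs_cong[OF 1(1)[of _ x]]) (use K \<sigma> in \<open>auto simp: fun_eq_iff fun_upd_apply\<close>)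
    have s3: "runs (move_onto (K + 2) 0 (K + 1)) (\<sigma>(0 := E x, K := D x)) (12 * (?n + poly p ?n) + 3)
        (\<sigma>(0 := [], K := D x, K + 1 := E x))"
      using K e \<sigma>(1) assms 1(2)[of x]
      by (intro runs_cong[OF runs_move_onto]) (auto simp: fun_eq_iff fun_upd_apply)
    have s4: "runs (move_onto (K + 2) K 0) (\<sigma>(0 := [], K := D x, K + 1 := E x)) (12 * ?n + 3)
        (\<sigma>(K + 1 := E x))"
      using K e \<sigma>(1) assms
      by (intro runs_cong[OF runs_move_onto]) (auto simp: fun_eq_iff fun_upd_apply)
    have s5: "runs d (\<sigma>(K + 1 := E x)) (poly q ?n) (\<sigma>(0 := F x, K + 1 := E x))"
      by (rule runs_cong[OF 2[of _ x]]) (use K \<sigma> in \<open>auto simp: fun_eq_iff fun_upd_apply\<close>)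
    have s6: "runs (move_onto (K + 2) (K + 1) 0) (\<sigma>(0 := F x, K + 1 := E x)) (12 * (?n + poly p ?n) + 3)
        (\<sigma>(0 := E x @ F x))"
      using K e \<sigma>(1) assms 1(2)[of x]
      by (intro runs_cong[OF runs_move_onto]) (auto simp: fun_eq_iff fun_upd_apply)
    show "runs ?c \<sigma> (?T ?n) (\<sigma>(0 := E x @ F x))"
      by (rule runs_Seq s1 s2 s3 s4 s5 s6)+
  qed
qed

text \<open>Each branch must be correct only where the test leads to it, which suits partial
  operations such as taking the head of a list.\<close>

lemma transforms_If:
  assumes "transforms D (\<lambda>x. [if b x then One else Zero])" "transforms_on {x. b x} D E" "transforms_on {x. \<not> b x} D F" "\<And>x. Blank \<notin> set (D x)"
  shows "transforms D (\<lambda>x. if b x then E x else F x)"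
proof -
  obtain c0 k0 p0 where 0: "\<And>x \<sigma>. \<sigma> 0 = D x \<Longrightarrow> (\<And>i. 0 < i \<Longrightarrow> i < k0 \<Longrightarrow> \<sigma> i = []) \<Longrightarrow>
       runs c0 \<sigma> (poly p0 (length (D x))) (\<sigma>(0 := [if b x then One else Zero]))"
    using transformsE[OF assms(1)] by metis
  obtain c1 k1 p1 where 1: "\<And>x \<sigma>. b x \<Longrightarrow> \<sigma> 0 = D x \<Longrightarrow> (\<And>i. 0 < i \<Longrightarrow> i < k1 \<Longrightarrow> \<sigma> i = []) \<Longrightarrow>
       runs c1 \<sigma> (poly p1 (length (D x))) (\<sigma>(0 := E x))"
    using assms(2) unfolding transforms_on_def mem_Collect_eq by metis
  obtain c2 k2 p2 where 2: "\<And>x \<sigma>. \<not> b x \<Longrightarrow> \<sigma> 0 = D x \<Longrightarrow> (\<And>i. 0 < i \<Longrightarrow> i < k2 \<Longrightarrow> \<sigma> i = []) \<Longrightarrow>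
       runs c2 \<sigma> (poly p2 (length (D x))) (\<sigma>(0 := F x))"
    using assms(3) unfolding transforms_on_def mem_Collect_eq by metis
  define K where "K = Suc (max k0 (max k1 k2))"
  have K: "0 < K" "k0 < K" "k1 < K" "k2 < K" by (auto simp: K_def)
  let ?back = "Pop 0 ;; move_onto (K + 1) K 0"
  let ?c = "copy_onto (K + 1) 0 K ;; c0 ;; Cond 0 {One} (?back ;; c1) (?back ;; c2)"
  let ?T = "\<lambda>n. (15 * n + 3) + (poly p0 n + (((1 + (12 * n + 3) + 1) + (poly p1 n + poly p2 n) + 1) + 1) + 1) + 1"
  show ?thesis
  proof (rule transformsI[where c = ?c and k = "K + 2" and T = ?T])
    show "poly_bounded ?T" by (intro poly_bounded_intros)
  next
    fix x and \<sigma> :: stacks assume \<sigma>: "\<sigma> 0 = D x" "\<And>i. 0 < i \<Longrightarrow> i < K + 2 \<Longrightarrow> \<sigma> i = []"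
    have e: "\<sigma> K = []" "\<sigma> (K + 1) = []" using \<sigma> K by auto
    let ?n = "length (D x)"
    let ?s = "\<sigma>(0 := [if b x then One else Zero], K := D x)"
    let ?r = "\<sigma>(0 := if b x then E x else F x)"
    have s1: "runs (copy_onto (K + 1) 0 K) \<sigma> (15 * ?n + 3) (\<sigma>(K := D x))"
      using K e \<sigma>(1) assms(4) by (intro runs_cong[OF runs_copy_onto]) auto
    have s2: "runs c0 (\<sigma>(K := D x)) (poly p0 ?n) ?s"
      by (rule runs_cong[OF 0[of _ x]]) (use K \<sigma> in \<open>auto simp: fun_eq_iff fun_upd_apply\<close>)
    have "runs (Pop 0) ?s 1 (\<sigma>(0 := [], K := D x))"
      using K by (intro runs_cong[OF runs_Pop]) (auto simp: fun_eq_iff fun_upd_apply)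
    moreover have "runs (move_onto (K + 1) K 0) (\<sigma>(0 := [], K := D x)) (12 * ?n + 3) \<sigma>"
      using K e \<sigma>(1) assms(4)
      by (intro runs_cong[OF runs_move_onto]) (auto simp: fun_eq_iff fun_upd_apply)
    ultimately have s3: "runs ?back ?s (1 + (12 * ?n + 3) + 1) \<sigma>" by (rule runs_Seq)
    have s4: "runs c1 \<sigma> (poly p1 ?n + poly p2 ?n) ?r" if "b x"
      by (rule runs_cong[OF 1[of x]]) (use that K \<sigma> in auto)
    have s5: "runs c2 \<sigma> (poly p1 ?n + poly p2 ?n) ?r" if "\<not> b x"
      by (rule runs_cong[OF 2[of x]]) (use that K \<sigma> in auto)
    have "runs (Cond 0 {One} (?back ;; c1) (?back ;; c2)) ?s
       (((1 + (12 * ?n + 3) + 1) + (poly p1 ?n + poly p2 ?n) + 1) + 1) ?r"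
    proof (rule runs_Cond)
      assume "stack_top (?s 0) \<in> {One}"
      then have "b x" using K by (auto split: if_splits)
      show "runs (?back ;; c1) ?s ((1 + (12 * ?n + 3) + 1) + (poly p1 ?n + poly p2 ?n) + 1) ?r"
        by (rule runs_Seq[OF s3 s4[OF \<open>b x\<close>]])
    next
      assume "stack_top (?s 0) \<notin> {One}"
      then have "\<not> b x" using K by (auto split: if_splits)
      show "runs (?back ;; c2) ?s ((1 + (12 * ?n + 3) + 1) + (poly p1 ?n + poly p2 ?n) + 1) ?r"
        by (rule runs_Seq[OF s3 s5[OF \<open>\<not> b x\<close>]])
    qed
    from runs_Seq[OF s1 runs_Seq[OF s2 this]]
    show "runs ?c \<sigma> (?T ?n) ?r" .
  qed
qed

text \<open>The number of blocks alone determines where \<open>A x\<close> ends. The rest must be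
  free of blanks, since \<open>clear\<close> takes a blank for the bottom of the stack.\<close>

lemma transforms_take:
  assumes "\<And>x. blocks n (A x)" "\<And>x. Blank \<notin> set (B x)"
  shows "transforms (\<lambda>x. A x @ B x) A"
proof (rule transformsI[where c = "take_blocks n 2 0 1 ;; clear 0 ;; rev_onto 1 0" and k = 3 and
      T = "\<lambda>n. 13 * n + ((3 * n + 1) + (6 * n + 1) + 1) + 1"])
  show "poly_bounded (\<lambda>n. 13 * n + ((3 * n + 1) + (6 * n + 1) + 1) + 1)" by (intro poly_bounded_intros)
next
  fix x and \<sigma> :: stacks assume \<sigma>: "\<sigma> 0 = A x @ B x" "\<And>i. 0 < i \<Longrightarrow> i < 3 \<Longrightarrow> \<sigma> i = []"
  have e: "\<sigma> 1 = []" "\<sigma> 2 = []" using \<sigma>(2) by auto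
  have nb: "Blank \<notin> set (A x)" using blocks_forest[OF assms(1)] forest_not_Blank by blast
  let ?m = "length (A x @ B x)"
  have s1: "runs (take_blocks n 2 0 1) \<sigma> (13 * ?m) (\<sigma>(0 := B x, 1 := rev (A x)))"
    using \<sigma>(1) e assms by (intro runs_cong[OF runs_take_blocks[of 0 1 2 n "A x" \<sigma> "B x"]]) auto
  have s2: "runs (clear 0) (\<sigma>(0 := B x, 1 := rev (A x))) (3 * ?m + 1) (\<sigma>(0 := [], 1 := rev (A x)))"
    using assms by (intro runs_cong[OF runs_clear]) (auto simp: fun_eq_iff fun_upd_apply)
  have s3: "runs (rev_onto 1 0) (\<sigma>(0 := [], 1 := rev (A x))) (6 * ?m + 1) (\<sigma>(0 := A x))"
    using nb e by (intro runs_cong[OF runs_rev_onto]) (auto simp: fun_eq_iff fun_upd_apply)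
  show "runs (take_blocks n 2 0 1 ;; clear 0 ;; rev_onto 1 0) \<sigma>
    (13 * ?m + ((3 * ?m + 1) + (6 * ?m + 1) + 1) + 1) (\<sigma>(0 := A x))"
    by (rule runs_Seq s1 s2 s3)+
qed

lemma transforms_drop:
  assumes "\<And>x. blocks n (A x)"
  shows "transforms (\<lambda>x. A x @ B x) B"
proof (rule transformsI[where c = "take_blocks n 2 0 1 ;; clear 1" and k = 3 and
      T = "\<lambda>n. 13 * n + (3 * n + 1) + 1"])
  show "poly_bounded (\<lambda>n. 13 * n + (3 * n + 1) + 1)" by (intro poly_bounded_intros)
next
  fix x and \<sigma> :: stacks assume \<sigma>: "\<sigma> 0 = A x @ B x" "\<And>i. 0 < i \<Longrightarrow> i < 3 \<Longrightarrow> \<sigma> i = []"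
  have e: "\<sigma> 1 = []" "\<sigma> 2 = []" using \<sigma>(2) by auto
  have nb: "Blank \<notin> set (A x)" using blocks_forest[OF assms(1)] forest_not_Blank by blast
  let ?m = "length (A x @ B x)"
  have s1: "runs (take_blocks n 2 0 1) \<sigma> (13 * ?m) (\<sigma>(0 := B x, 1 := rev (A x)))"
    using \<sigma>(1) e assms by (intro runs_cong[OF runs_take_blocks[of 0 1 2 n "A x" \<sigma> "B x"]]) auto
  have s2: "runs (clear 1) (\<sigma>(0 := B x, 1 := rev (A x))) (3 * ?m + 1) (\<sigma>(0 := B x))"
    using nb e by (intro runs_cong[OF runs_clear]) (auto simp: fun_eq_iff fun_upd_apply)
  show "runs (take_blocks n 2 0 1 ;; clear 1) \<sigma> (13 * ?m + (3 * ?m + 1) + 1) (\<sigma>(0 := B x))"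
    by (rule runs_Seq s1 s2)+
qed

lemma transforms_Push: "transforms D (\<lambda>x. a # D x)"
proof (rule transformsI[where c = "Push 0 a" and k = 0 and T = "\<lambda>n. 2"])
  show "poly_bounded (\<lambda>n. 2)" by (intro poly_bounded_intros)
next
  fix x and \<sigma> :: stacks assume "\<sigma> 0 = D x"
  then show "runs (Push 0 a) \<sigma> 2 (\<sigma>(0 := a # D x))" using runs_Push[of 0 a \<sigma>] by simp
qed

lemma transforms_Pop: "transforms D (\<lambda>x. tl (D x))"
proof (rule transformsI[where c = "Pop 0" and k = 0 and T = "\<lambda>n. 1"])
  show "poly_bounded (\<lambda>n. 1)" by (intro poly_bounded_intros)
next
  fix x and \<sigma> :: stacks assume "\<sigma> 0 = D x"
  then show "runs (Pop 0) \<sigma> 1 (\<sigma>(0 := tl (D x)))" using runs_Pop[of 0 \<sigma>] by simp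
qed

lemma transforms_top_test:
  assumes "\<And>x. Blank \<notin> set (D x)"
  shows "transforms D (\<lambda>x. [if stack_top (D x) \<in> S then One else Zero])"
proof (rule transformsI[where c = "Cond 0 S (clear 0 ;; push_all 0 [One]) (clear 0 ;; push_all 0 [Zero])" and k = 0
    and T = "\<lambda>n. (3 * n + 1) + 3 + 1 + 1"])
  show "poly_bounded (\<lambda>n. (3 * n + 1) + 3 + 1 + 1)" by (intro poly_bounded_intros)
next
  fix x and \<sigma> :: stacks assume \<sigma>: "\<sigma> 0 = D x"
  have "runs (clear 0 ;; push_all 0 [a]) \<sigma> ((3 * length (D x) + 1) + 3 + 1) (\<sigma>(0 := [a]))" for a
    using assms[of x] runs_clear[of \<sigma> 0] \<sigma>
    by (intro runs_cong[OF runs_Seq[OF _ runs_push_all]]) auto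
  then show "runs (Cond 0 S (clear 0 ;; push_all 0 [One]) (clear 0 ;; push_all 0 [Zero])) \<sigma>
     ((3 * length (D x) + 1) + 3 + 1 + 1) (\<sigma>(0 := [if stack_top (D x) \<in> S then One else Zero]))"
    by (intro runs_Cond) (auto simp: \<sigma>)
qed


section \<open>Polynomial-time functions\<close>

text \<open>The number of blocks is a constant of the type, so a fixed program can cut a value off
  the front of a word. Positive width makes encodings nonempty, which the end-of-list test relies
  on.\<close>

class encodable =
  fixes encode :: "'a \<Rightarrow> sym list"
    and width :: "'a itself \<Rightarrow> nat"
  assumes blocks_encode: "blocks (width TYPE('a)) (encode x)"
    and width_pos: "0 < width TYPE('a)"

lemma encode_not_Blank: "Blank \<notin> set (encode x)"
  using blocks_forest[OF blocks_encode] forest_not_Blank by blast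

lemma forest_encode: "forest (encode x)"
  using blocks_forest[OF blocks_encode] .

lemma encode_top: "stack_top (encode (x :: 'a :: encodable) @ r) \<in> {Zero, One, Open}"
  using blocks_top[OF blocks_encode width_pos] .

lemma length_encode_pos: "0 < length (encode x)"
  using encode_top[of x "[]"] by (cases "encode x") auto

lemma forest_concat: "(\<And>x. x \<in> set xs \<Longrightarrow> forest (f x)) \<Longrightarrow> forest (concat (map f xs))"
  by (induction xs) (auto intro: forest_append forest_Nil)

lemma blocks_enc_list: "(\<And>x. forest (f x)) \<Longrightarrow> blocks 1 (enc_list f xs)"
  unfolding enc_list_def by (auto intro!: blocks_single block_Node forest_concat)

section \<open>Encodings of the basic types\<close>

instantiation bool :: encodable
begin
definition "encode b = [if b then One else Zero]"
definition "width (T :: bool itself) = 1"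
instance by standard (auto simp: encode_bool_def width_bool_def intro: blocks_single block.intros)
end

instantiation list :: (encodable) encodable
begin
definition "encode xs = enc_list encode xs"
definition "width (T :: 'a list itself) = 1"
instance by standard (auto simp: encode_list_def width_list_def intro!: blocks_enc_list[simplified] forest_encode)
end

text \<open>Pairs carry no delimiters, so that the input of the machine is the encoding of a tuple.\<close>

instantiation prod :: (encodable, encodable) encodable
begin
definition "encode z = encode (fst z) @ encode (snd z)"
definition "width (T :: ('a \<times> 'b) itself) = width TYPE('a) + width TYPE('b)"
instance by standard (auto simp: encode_prod_def width_prod_def blocks_encode width_pos intro: blocks_append)
end

lemma forest_bits: "forest (bits n)"
  by (induction n rule: bits.induct) (subst bits.simps, auto intro: forest.intros)

instantiation nat :: encodable
begin
definition "encode n = enc_nat n"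
definition "width (T :: nat itself) = 1"
instance by standard (auto simp: encode_nat_def width_nat_def enc_nat_def intro!: blocks_single block_Node forest_bits)
end

instantiation rat :: encodable
begin
definition "encode x = enc_rat x"
definition "width (T :: rat itself) = 2"
instance
proof
  fix x :: rat
  obtain a b where q: "quotient_of x = (a, b)" by fastforce
  have "block (enc_int a)" "block (enc_nat (nat b))"
    using block_Node[OF forest_Zero[OF forest_bits]] block_Node[OF forest_One[OF forest_bits]]
      block_Node[OF forest_bits]
    by (auto simp: enc_int_def enc_nat_def)
  from blocks_append[OF this[THEN blocks_single]]
  show "blocks (width TYPE(rat)) (encode x)" by (simp add: encode_rat_def width_rat_def enc_rat_def q numeral_2_eq_2)
qed (simp add: width_rat_def)
end


section \<open>Closure properties of polynomial-time functions\<close>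

definition poly_time :: "('a :: encodable \<Rightarrow> 'b :: encodable) \<Rightarrow> bool" where
  "poly_time f \<longleftrightarrow> transforms encode (\<lambda>x. encode (f x))"

named_theorems poly_time_intros

lemma poly_time_id [poly_time_intros]: "poly_time (\<lambda>x. x)"
  unfolding poly_time_def by (rule transforms_id)

lemma poly_time_const [poly_time_intros]: "poly_time (\<lambda>x. c)"
  unfolding poly_time_def by (rule transforms_const) (rule encode_not_Blank)

lemma poly_time_comp:
  assumes "poly_time g" "poly_time f"
  shows "poly_time (\<lambda>x. g (f x))"
  using transforms_comp[OF assms(2)[unfolded poly_time_def] transforms_reindex[OF assms(1)[unfolded poly_time_def]]]
  unfolding poly_time_def .

lemma poly_time_size:
  assumes "poly_time f"
  shows "\<exists>p. \<forall>x. length (encode (f x)) \<le> poly p (length (encode x))"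
proof -
  obtain p where p: "length (encode (f x)) \<le> length (encode x) + poly p (length (encode x))" for x
    using transformsE[OF assms[unfolded poly_time_def]] by metis
  then show ?thesis by (intro exI[of _ "[:0, 1:] + p"]) simp
qed

lemma poly_time_Pair [poly_time_intros]:
  "poly_time f \<Longrightarrow> poly_time g \<Longrightarrow> poly_time (\<lambda>x. (f x, g x))"
  unfolding poly_time_def encode_prod_def fst_conv snd_conv
  by (rule transforms_append) (auto simp: encode_not_Blank)

lemma poly_time_If [poly_time_intros]:
  "poly_time b \<Longrightarrow> poly_time f \<Longrightarrow> poly_time g \<Longrightarrow> poly_time (\<lambda>x. if b x then f x else g x)"
  unfolding poly_time_def encode_bool_def if_distrib[of encode]
  by (rule transforms_If) (auto simp: encode_not_Blank intro: transforms_imp_on)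

lemma poly_time_fst [poly_time_intros]:
  fixes f :: "'a :: encodable \<Rightarrow> 'b :: encodable \<times> 'c :: encodable"
  assumes "poly_time f"
  shows "poly_time (\<lambda>x. fst (f x))"
proof (rule poly_time_comp[OF _ assms])
  show "poly_time (fst :: 'b \<times> 'c \<Rightarrow> 'b)"
    unfolding poly_time_def encode_prod_def by (rule transforms_take[OF blocks_encode encode_not_Blank])
qed

lemma poly_time_snd [poly_time_intros]:
  fixes f :: "'a :: encodable \<Rightarrow> 'b :: encodable \<times> 'c :: encodable"
  assumes "poly_time f"
  shows "poly_time (\<lambda>x. snd (f x))"
proof (rule poly_time_comp[OF _ assms])
  show "poly_time (snd :: 'b \<times> 'c \<Rightarrow> 'c)"
    unfolding poly_time_def encode_prod_def by (rule transforms_drop[OF blocks_encode])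
qed

lemma poly_time_not [poly_time_intros]:
  assumes "poly_time f"
  shows "poly_time (\<lambda>x. \<not> f x)"
proof -
  have "(\<lambda>x. \<not> f x) = (\<lambda>x. if f x then False else True)" by auto
  then show ?thesis by (simp only:) (intro poly_time_intros assms)
qed

lemma poly_time_conj [poly_time_intros]:
  assumes "poly_time f" "poly_time g"
  shows "poly_time (\<lambda>x. f x \<and> g x)"
proof -
  have "(\<lambda>x. f x \<and> g x) = (\<lambda>x. if f x then g x else False)" by auto
  then show ?thesis by (simp only:) (intro poly_time_intros assms)
qed

lemma poly_time_disj [poly_time_intros]:
  assumes "poly_time f" "poly_time g"
  shows "poly_time (\<lambda>x. f x \<or> g x)"
proof -
  have "(\<lambda>x. f x \<or> g x) = (\<lambda>x. if f x then True else g x)" by auto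
  then show ?thesis by (simp only:) (intro poly_time_intros assms)
qed

lemma poly_time_iff [poly_time_intros]:
  assumes "poly_time f" "poly_time g"
  shows "poly_time (\<lambda>x. f x = (g x :: bool))"
proof -
  have "(\<lambda>x. f x = (g x :: bool)) = (\<lambda>x. if f x then g x else \<not> g x)" by auto
  then show ?thesis by (simp only:) (intro poly_time_intros assms)
qed

text \<open>Without its opening symbol a list is the sequence of its items closed by
  \<open>Close\<close>. In this form adding or removing the first item is plain concatenation or
  splitting of words.\<close>

lemma encode_list_simps:
  "encode [] = [Open, Close]"
  "encode (x # xs) = Open # encode x @ tl (encode xs)"
  "encode xs = Open # tl (encode xs)"
  by (simp_all add: encode_list_def enc_list_def)

lemma tl_encode_list_not_Blank: "Blank \<notin> set (tl (encode (xs :: 'a :: encodable list)))"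
  using encode_not_Blank[of xs] by (subst (asm) encode_list_simps(3)) simp

lemma poly_time_null [poly_time_intros]:
  assumes "poly_time (f :: 'a :: encodable \<Rightarrow> 'b :: encodable list)"
  shows "poly_time (\<lambda>x. f x = [])"
proof (rule poly_time_comp[OF _ assms])
  have "transforms (encode :: 'b list \<Rightarrow> _) (\<lambda>xs. [if stack_top (tl (encode xs)) \<in> {Close} then One else Zero])"
    by (rule transforms_comp[OF transforms_Pop transforms_top_test]) (rule tl_encode_list_not_Blank)
  also have "(\<lambda>xs :: 'b list. [if stack_top (tl (encode xs)) \<in> {Close} then One else Zero]) = (\<lambda>xs. encode (xs = []))"
  proof
    fix xs :: "'b list"
    show "[if stack_top (tl (encode xs)) \<in> {Close} then One else Zero] = encode (xs = [])"
    proof (cases xs)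
      case (Cons x ys)
      with encode_top[of x "tl (encode ys)"] show ?thesis
        by (auto simp: encode_list_simps(2) encode_bool_def)
    qed (simp add: encode_list_simps(1) encode_bool_def)
  qed
  finally show "poly_time (\<lambda>xs :: 'b list. xs = [])" unfolding poly_time_def .
qed

text \<open>Whatever \<open>F []\<close> may be, even an unspecified value such as
  \<open>hd []\<close>, it is one fixed value and can be written by a constant program.\<close>

lemma poly_time_nonempty_cases:
  fixes F :: "'a :: encodable list \<Rightarrow> 'b :: encodable"
  assumes "transforms (\<lambda>z. encode (fst z # snd z)) (\<lambda>z. encode (F (fst z # snd z)))"
  shows "poly_time F"
proof -
  have "transforms_on {xs. xs \<noteq> []} encode (\<lambda>xs. encode (F xs))"
    by (rule transforms_on_cover[OF assms]) (metis (full_types) fst_conv snd_conv list.exhaust mem_Collect_eq)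
  then have "transforms encode (\<lambda>xs. if xs \<noteq> [] then encode (F xs) else encode (F []))"
    using poly_time_not[OF poly_time_null[OF poly_time_id]]
    unfolding poly_time_def encode_bool_def
    by (intro transforms_If transforms_imp_on[OF transforms_const]) (auto simp: encode_not_Blank)
  also have "(\<lambda>xs. if xs \<noteq> [] then encode (F xs) else encode (F [])) = (\<lambda>xs. encode (F xs))" by auto
  finally show ?thesis unfolding poly_time_def .
qed

lemma transforms_encode_Cons_Pop: "transforms (\<lambda>z. encode (fst z # snd z)) (\<lambda>z. encode (fst z) @ tl (encode (snd z)))"
  using transforms_Pop[of "\<lambda>z. encode (fst z # snd z)"] by (simp add: encode_list_simps(2))

lemma poly_time_hd [poly_time_intros]:
  fixes f :: "'a :: encodable \<Rightarrow> 'b :: encodable list"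
  assumes "poly_time f"
  shows "poly_time (\<lambda>x. hd (f x))"
proof (rule poly_time_comp[OF poly_time_nonempty_cases assms])
  show "transforms (\<lambda>z. encode (fst z # snd z)) (\<lambda>z. encode (hd (fst z # snd z) :: 'b))"
    unfolding list.sel
    by (rule transforms_comp[OF transforms_encode_Cons_Pop transforms_take[OF blocks_encode tl_encode_list_not_Blank]])
qed

lemma poly_time_tl [poly_time_intros]:
  fixes f :: "'a :: encodable \<Rightarrow> 'b :: encodable list"
  assumes "poly_time f"
  shows "poly_time (\<lambda>x. tl (f x))"
proof (rule poly_time_comp[OF poly_time_nonempty_cases assms])
  have "transforms (\<lambda>z. encode (fst z # snd z)) (\<lambda>z. tl (encode (snd z :: 'b list)))"
    by (rule transforms_comp[OF transforms_encode_Cons_Pop transforms_drop[OF blocks_encode]])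
  from transforms_comp[OF this transforms_Push[of _ Open]]
  show "transforms (\<lambda>z. encode (fst z # snd z)) (\<lambda>z. encode (tl (fst z # snd z) :: 'b list))"
    by (simp add: encode_list_simps(3)[symmetric])
qed

lemma poly_time_Cons [poly_time_intros]:
  fixes f :: "'a :: encodable \<Rightarrow> 'b :: encodable"
  assumes "poly_time f" "poly_time g"
  shows "poly_time (\<lambda>x. f x # g x)"
proof -
  have fst: "transforms (encode :: 'b \<times> 'b list \<Rightarrow> _) (\<lambda>z. encode (fst z))"
    using poly_time_fst[OF poly_time_id] unfolding poly_time_def .
  have snd: "transforms (encode :: 'b \<times> 'b list \<Rightarrow> _) (\<lambda>z. tl (encode (snd z)))"
    using transforms_comp[OF poly_time_snd[OF poly_time_id, unfolded poly_time_def] transforms_Pop] .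
  have "transforms (encode :: 'b \<times> 'b list \<Rightarrow> _) (\<lambda>z. encode (fst z) @ tl (encode (snd z)))"
    by (rule transforms_append[OF fst snd]) (rule encode_not_Blank)+
  from transforms_comp[OF this transforms_Push[of _ Open]]
  have "poly_time (\<lambda>z :: 'b \<times> 'b list. fst z # snd z)"
    unfolding poly_time_def encode_list_simps(2) .
  from poly_time_comp[OF this poly_time_Pair[OF assms]] show ?thesis by simp
qed


section \<open>Folds\<close>

text \<open>The increment of \<mu> in \<open>grow\<close> depends on the environment and the item
  but not on the accumulator. After at most \<open>n\<close> items \<mu> is thus polynomial in
  \<open>n\<close>, and by \<open>size\<close> so is the length of every intermediate value, at
  which the time of the step is evaluated.\<close>

lemma poly_time_fold:
  fixes F :: "'e :: encodable \<Rightarrow> 'a :: encodable \<Rightarrow> 'b :: encodable \<Rightarrow> 'b" and \<mu> :: "'b \<Rightarrow> nat"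
  assumes step: "poly_time (\<lambda>z. F (fst z) (fst (snd z)) (snd (snd z)))"
    and l: "poly_time l" and s: "poly_time s"
    and grow: "\<And>e x b. \<mu> (F e x b) \<le> \<mu> b + poly q (length (encode e) + length (encode x))"
    and size: "\<And>b. \<mu> b \<le> length (encode b)" "\<And>b. length (encode b) \<le> poly r (\<mu> b)"
  shows "poly_time (\<lambda>e. fold (F e) (l e) (s e))"
proof -
  obtain c k p where c: "\<And>z \<sigma>. \<sigma> 0 = encode z \<Longrightarrow> (\<And>i. 0 < i \<Longrightarrow> i < k \<Longrightarrow> \<sigma> i = []) \<Longrightarrow>
       runs c \<sigma> (poly p (length (encode z))) (\<sigma>(0 := encode (F (fst z) (fst (snd z)) (snd (snd z)))))"
    using transformsE[OF step[unfolded poly_time_def]] by metis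
  \<comment> \<open>Four stacks beyond the scratch space of \<open>c\<close>: remaining items,
    environment, a reversed piece in transit, and the parenthesis counter. The accumulator stays on
    stack 0.\<close>
  define L E R d where "L = Suc k" and "E = Suc (Suc k)" and "R = Suc (Suc (Suc k))" and "d = Suc (Suc (Suc (Suc k)))"
  note dist = L_def E_def R_def d_def
  \<comment> \<open>The next item and then a copy of the environment are put on top of the
    accumulator, which yields the encoding of the triple expected by \<open>c\<close>.\<close>
  define body where "body = take_blocks (width TYPE('a)) d L R ;; rev_onto R 0 ;; copy_onto d E 0 ;; c"
  define main where "main = Loop L {Zero, One, Open} body"
  define prog where "prog = take_blocks 1 d 0 R ;; rev_onto R L ;; Pop L ;;
     take_blocks (width TYPE('e)) d 0 R ;; rev_onto R E ;; main ;; Pop L ;; clear E"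
  define items where "items zs = concat (map encode zs) @ [Close]" for zs :: "'a list"
  \<comment> \<open>The three summands bound the environment, one item, and the accumulator after at
    most \<open>n\<close> items.\<close>
  define S where "S n = n + n + poly r (n + n * poly q (n + n))" for n :: nat
  define B where "B n = 13 * n + ((6 * n + 1) + ((15 * n + 3) + poly p (S n) + 1) + 1) + 1" for n :: nat
  define T where "T n = 13 * n + ((6 * n + 1) + (1 + (13 * n + ((6 * n + 1) + ((n * (B n + 2) + 1) +
    (1 + (3 * n + 1) + 1) + 1) + 1) + 1) + 1) + 1) + 1" for n :: nat
  \<comment> \<open>The order matches the program: the list is cut off first, the environment next,
    and the start value is left on stack 0 as the first accumulator.\<close>
  define D where "D e = encode (l e) @ encode e @ encode (s e)" for e
  have core: "transforms D (\<lambda>e. encode (fold (F e) (l e) (s e)))"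
  proof (rule transformsI[where c = prog and k = "k + 5" and T = T])
    show "poly_bounded T" unfolding T_def B_def S_def by (intro poly_bounded_intros)
  next
    fix e and \<sigma> :: stacks
    assume \<sigma>: "\<sigma> 0 = D e" "\<And>i. 0 < i \<Longrightarrow> i < k + 5 \<Longrightarrow> \<sigma> i = []"
    let ?n = "length (D e)"
    have empty: "\<sigma> L = []" "\<sigma> E = []" "\<sigma> R = []" "\<sigma> d = []" using \<sigma>(2) dist by auto
    have item: "length (encode x) \<le> ?n" if "x \<in> set (l e)" for x
    proof -
      have "length (encode x) \<le> length (concat (map encode (l e)))"
        using that by (simp add: length_concat member_le_sum_list)
      also have "\<dots> \<le> ?n" by (simp add: D_def encode_list_def enc_list_def)
      finally show ?thesis .
    qed
    have len_l: "length (l e) \<le> ?n"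
    proof -
      have "length xs \<le> length (concat (map encode xs))" for xs :: "'a list"
      proof (induction xs)
        case (Cons x xs)
        have "length (encode x) > 0" by (rule length_encode_pos)
        with Cons show ?case unfolding list.map concat.simps length_append list.size by linarith
      qed simp
      from this[of "l e"] show ?thesis by (simp add: D_def encode_list_def enc_list_def)
    qed
    have acc: "\<mu> (fold (F e) ys (s e)) \<le> ?n + length ys * poly q (?n + ?n)" if "set ys \<subseteq> set (l e)" for ys
      using that
    proof (induction ys rule: rev_induct)
      case Nil
      then show ?case using size(1)[of "s e"] by (simp add: D_def)
    next
      case (snoc y ys)
      have "length (encode e) + length (encode y) \<le> ?n + ?n"
        using item[of y] snoc.prems by (intro add_mono) (auto simp: D_def)
      from poly_nat_mono[OF this, of q] grow[of e y "fold (F e) ys (s e)"] snoc show ?case by simp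
    qed
    have acc_size: "length (encode (fold (F e) ys (s e))) \<le> poly r (?n + ?n * poly q (?n + ?n))"
      if "ys @ zs = l e" for ys zs
    proof -
      have "length ys \<le> ?n" "set ys \<subseteq> set (l e)" using len_l unfolding that[symmetric] by auto
      then have "\<mu> (fold (F e) ys (s e)) \<le> ?n + length ys * poly q (?n + ?n)"
        "length ys * poly q (?n + ?n) \<le> ?n * poly q (?n + ?n)"
        using acc[of ys] by simp_all
      then have "\<mu> (fold (F e) ys (s e)) \<le> ?n + ?n * poly q (?n + ?n)" by linarith
      from order_trans[OF size(2) poly_nat_mono[OF this]] show ?thesis .
    qed
    define st where "st zs b = \<sigma>(L := items zs, E := encode e, 0 := encode b)" for zs and b :: 'b
    have loop: "runs main (st zs (fold (F e) ys (s e))) (length zs * (B ?n + 2) + 1) (st [] (fold (F e) (l e) (s e)))"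
      if "ys @ zs = l e" for ys zs
      using that
    proof (induction zs arbitrary: ys)
      case Nil
      have "stack_top (st [] (fold (F e) ys (s e)) L) \<notin> {Zero, One, Open}"
        using dist by (simp add: st_def items_def)
      from runs_Loop_exit[of "st [] (fold (F e) ys (s e))" L, OF this] Nil show ?case by (simp add: main_def)
    next
      case (Cons x zs)
      let ?b = "fold (F e) ys (s e)"
      have x: "length (encode x) \<le> ?n" using item[of x] Cons.prems by (metis in_set_conv_decomp)
      have bs: "length (encode ?b) \<le> poly r (?n + ?n * poly q (?n + ?n))" using acc_size[OF Cons.prems] .
      let ?s1 = "\<sigma>(L := items zs, E := encode e, 0 := encode ?b, R := rev (encode x))"
      let ?s2 = "\<sigma>(L := items zs, E := encode e, 0 := encode x @ encode ?b)"
      let ?s3 = "\<sigma>(L := items zs, E := encode e, 0 := encode (e, x, ?b))"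
      have e1: "runs (take_blocks (width TYPE('a)) d L R) (st (x # zs) ?b) (13 * ?n) ?s1"
        by (rule runs_cong[OF runs_take_blocks[where w = "encode x" and r = "items zs"]])
          (use dist empty x blocks_encode in \<open>auto simp: st_def items_def fun_eq_iff fun_upd_apply\<close>)
      have e2: "runs (rev_onto R 0) ?s1 (6 * ?n + 1) ?s2"
        by (rule runs_cong[OF runs_rev_onto])
          (use dist empty x encode_not_Blank in \<open>auto simp: fun_eq_iff fun_upd_apply\<close>)
      have e3: "runs (copy_onto d E 0) ?s2 (15 * ?n + 3) ?s3"
        by (rule runs_cong[OF runs_copy_onto])
          (use dist empty encode_not_Blank in \<open>auto simp: fun_eq_iff fun_upd_apply encode_prod_def D_def\<close>)
      have "length (encode (e, x, ?b)) \<le> S ?n"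
        using x bs by (simp add: S_def encode_prod_def D_def)
      then have e4: "runs c ?s3 (poly p (S ?n)) (st zs (F e x ?b))"
        by (intro runs_cong[OF c[of _ "(e, x, ?b)"]])
          (use dist \<sigma>(2) in \<open>auto simp: st_def fun_eq_iff fun_upd_apply poly_nat_mono\<close>)
      have b: "runs body (st (x # zs) ?b) (B ?n) (st zs (F e x ?b))"
        unfolding body_def B_def by (rule runs_Seq e1 e2 e3 e4)+
      have "runs main (st zs (F e x ?b)) (length zs * (B ?n + 2) + 1) (st [] (fold (F e) (l e) (s e)))"
        using Cons.IH[of "ys @ [x]"] Cons.prems by simp
      from runs_Loop_step[OF _ b this[unfolded main_def]]
      show ?case
        unfolding main_def
        by (rule runs_mono) (use dist encode_top[of x] in \<open>auto simp: st_def items_def\<close>)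
    qed
    let ?A = "encode e @ encode (s e)"
    let ?t1 = "\<sigma>(0 := ?A, R := rev (encode (l e)))"
    let ?t2 = "\<sigma>(0 := ?A, L := encode (l e))"
    let ?t3 = "\<sigma>(0 := ?A, L := items (l e))"
    let ?t4 = "\<sigma>(0 := encode (s e), L := items (l e), R := rev (encode e))"
    let ?r = "fold (F e) (l e) (s e)"
    let ?t6 = "\<sigma>(L := [], E := encode e, 0 := encode ?r)"
    have s1: "runs (take_blocks 1 d 0 R) \<sigma> (13 * ?n) ?t1"
      by (rule runs_cong[OF runs_take_blocks[where w = "encode (l e)" and r = ?A]])
        (use dist empty \<sigma>(1) blocks_encode[of "l e"] in \<open>auto simp: D_def width_list_def\<close>)
    have s2: "runs (rev_onto R L) ?t1 (6 * ?n + 1) ?t2"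
      by (rule runs_cong[OF runs_rev_onto])
        (use dist empty encode_not_Blank in \<open>auto simp: D_def fun_eq_iff fun_upd_apply\<close>)
    have s3: "runs (Pop L) ?t2 1 ?t3"
      by (rule runs_cong[OF runs_Pop]) (use dist in \<open>auto simp: encode_list_def enc_list_def items_def\<close>)
    have s4: "runs (take_blocks (width TYPE('e)) d 0 R) ?t3 (13 * ?n) ?t4"
      by (rule runs_cong[OF runs_take_blocks[where w = "encode e" and r = "encode (s e)"]])
        (use dist empty blocks_encode in \<open>auto simp: D_def fun_eq_iff fun_upd_apply\<close>)
    have s5: "runs (rev_onto R E) ?t4 (6 * ?n + 1) (st (l e) (s e))"
      by (rule runs_cong[OF runs_rev_onto])
        (use dist empty encode_not_Blank in \<open>auto simp: D_def st_def fun_eq_iff fun_upd_apply\<close>)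
    have s6: "runs main (st (l e) (s e)) (?n * (B ?n + 2) + 1) (st [] ?r)"
      by (rule runs_mono[OF loop[of "[]" "l e", simplified]]) (use len_l in \<open>auto intro!: add_mono mult_right_mono\<close>)
    have s7: "runs (Pop L) (st [] ?r) 1 ?t6"
      by (rule runs_cong[OF runs_Pop]) (use dist in \<open>auto simp: st_def items_def fun_eq_iff fun_upd_apply\<close>)
    have s8: "runs (clear E) ?t6 (3 * ?n + 1) (\<sigma>(0 := encode ?r))"
      by (rule runs_cong[OF runs_clear])
        (use dist empty encode_not_Blank in \<open>auto simp: D_def fun_eq_iff fun_upd_apply\<close>)
    show "runs prog \<sigma> (T ?n) (\<sigma>(0 := encode ?r))"
      unfolding prog_def T_def by (rule runs_Seq s1 s2 s3 s4 s5 s6 s7 s8)+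
  qed
  have "poly_time (\<lambda>e. (l e, e, s e))" by (intro poly_time_intros l s)
  then have "transforms encode D" unfolding poly_time_def D_def by (simp add: encode_prod_def)
  from transforms_comp[OF this core] show ?thesis unfolding poly_time_def .
qed

lemma poly_time_fold_length:
  fixes F :: "'e :: encodable \<Rightarrow> 'a :: encodable \<Rightarrow> 'b :: encodable \<Rightarrow> 'b"
  assumes "poly_time (\<lambda>z. F (fst z) (fst (snd z)) (snd (snd z)))" "poly_time l" "poly_time s"
    and "\<And>e x b. length (encode (F e x b)) \<le> length (encode b) + poly q (length (encode e) + length (encode x))"
  shows "poly_time (\<lambda>e. fold (F e) (l e) (s e))"
  by (rule poly_time_fold[where \<mu> = "\<lambda>b. length (encode b)" and r = "[:0, 1:]", OF assms]) auto

lemma poly_time_rev [poly_time_intros]: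
  assumes "poly_time f" shows "poly_time (\<lambda>x. rev (f x))"
proof -
  have "poly_time (\<lambda>x. fold Cons (f x) [])"
    by (rule poly_time_fold_length[where q = "[:0, 1:]"])
      (auto intro!: poly_time_intros assms simp: encode_list_def enc_list_def)
  then show ?thesis by (simp add: fold_Cons_rev)
qed

text \<open>The outer argument \<open>e\<close> remains available inside the map. The nested maps in
  the sum over pairs depend on this.\<close>

lemma poly_time_map:
  assumes F: "poly_time (\<lambda>z. F (fst z) (snd z))" and l: "poly_time l"
  shows "poly_time (\<lambda>e. map (F e) (l e))"
proof -
  obtain q where q: "length (encode (F e x)) \<le> poly q (length (encode e) + length (encode x))" for e x
    using poly_time_size[OF F] by (auto simp: encode_prod_def)
  have "poly_time (\<lambda>e. fold (\<lambda>x b. F e x # b) (l e) [])"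
  proof (rule poly_time_fold_length[where q = q])
    have "poly_time (\<lambda>z. F (fst z) (fst (snd z)))"
      using poly_time_comp[OF F, of "\<lambda>z. (fst z, fst (snd z))"] by (simp add: poly_time_intros)
    then show "poly_time (\<lambda>z. F (fst z) (fst (snd z)) # snd (snd z))"
      by (intro poly_time_intros)
  qed (use q l in \<open>auto intro!: poly_time_intros simp: encode_list_def enc_list_def\<close>)
  then have "poly_time (\<lambda>e. rev (fold (\<lambda>x b. F e x # b) (l e) []))" by (rule poly_time_rev)
  moreover have "rev (fold (\<lambda>x b. F e x # b) xs []) = map (F e) xs" for e xs
  proof -
    have "fold (\<lambda>x b. F e x # b) xs ys = rev (map (F e) xs) @ ys" for ys
      by (induction xs arbitrary: ys) auto
    then show ?thesis by simp
  qed
  ultimately show ?thesis by simp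
qed


section \<open>Binary arithmetic\<close>

lemma poly_time_zip [poly_time_intros]:
  fixes f :: "'c :: encodable \<Rightarrow> 'a :: encodable list" and g :: "'c \<Rightarrow> 'b :: encodable list"
  assumes "poly_time f" "poly_time g"
  shows "poly_time (\<lambda>x. zip (f x) (g x))"
proof -
  \<comment> \<open>The accumulator holds the unread part of the second list and the reversed
    output. An entry of the second list only moves between the two, so just the item
    \<open>x\<close> contributes to the growth.\<close>
  define F :: "'c \<Rightarrow> 'a \<Rightarrow> 'b list \<times> ('a \<times> 'b) list \<Rightarrow> 'b list \<times> ('a \<times> 'b) list"
    where "F = (\<lambda>e x b. if fst b = [] then b else (tl (fst b), (x, hd (fst b)) # snd b))"
  have "poly_time (\<lambda>e. fold (F e) (f e) (g e, []))"
  proof (rule poly_time_fold_length[where q = "[:0, 1:]"])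
    show "poly_time (\<lambda>z. F (fst z) (fst (snd z)) (snd (snd z)))"
      unfolding F_def by (intro poly_time_intros)
    show "poly_time (\<lambda>e. (g e, []))" by (intro poly_time_intros assms)
    show "length (encode (F e x b)) \<le> length (encode b) + poly [:0, 1:] (length (encode e) + length (encode x))" for e x b
      by (cases b; cases "fst b") (auto simp: F_def encode_prod_def encode_list_def enc_list_def)
  qed (rule assms)
  then have "poly_time (\<lambda>e. rev (snd (fold (F e) (f e) (g e, []))))" by (intro poly_time_intros)
  moreover have "snd (fold (F e) xs (ys, zs)) = rev (zip xs ys) @ zs" for e xs ys zs
    by (induction xs arbitrary: ys zs) (auto simp: F_def zip_Cons1 split: list.splits)
  ultimately show ?thesis by simp
qed

section \<open>Binary digits of natural numbers\<close>

fun nat_bits :: "nat \<Rightarrow> bool list" where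
  "nat_bits n = (if n = 0 then [] else odd n # nat_bits (n div 2))"

declare nat_bits.simps [simp del]

fun lsb_val :: "bool list \<Rightarrow> nat" where
  "lsb_val [] = 0"
| "lsb_val (b # bs) = of_bool b + 2 * lsb_val bs"

lemma lsb_val_append: "lsb_val (xs @ ys) = lsb_val xs + 2 ^ length xs * lsb_val ys"
  by (induction xs) (auto simp: algebra_simps)

lemma lsb_val_nat_bits: "lsb_val (nat_bits n) = n"
  by (induction n rule: nat_bits.induct) (subst nat_bits.simps, auto elim: oddE)

lemma nat_bits_0: "nat_bits 0 = []"
  by (simp add: nat_bits.simps)

lemma nat_bits_eq_Nil_iff: "nat_bits n = [] \<longleftrightarrow> n = 0"
  by (simp add: nat_bits.simps[of n])

lemma nat_bits_double: "nat_bits (of_bool b + 2 * n) = (if nat_bits n = [] \<and> \<not> b then [] else b # nat_bits n)"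
  by (auto simp: nat_bits.simps[of "of_bool b + 2 * n"] nat_bits_eq_Nil_iff)

text \<open>A number and its list of digits are the same word. Reading a number as a list costs
  nothing, and arithmetic becomes a matter of folds over lists of booleans.\<close>

lemma encode_nat_bits: "encode (nat_bits n) = encode n"
proof -
  have "concat (map encode bs) = map (\<lambda>b. if b then One else Zero) bs" for bs
    by (induction bs) (auto simp: encode_bool_def)
  moreover have "map (\<lambda>b. if b then One else Zero) (nat_bits n) = bits n"
    by (induction n rule: nat_bits.induct) (subst nat_bits.simps, subst bits.simps, auto)
  ultimately show ?thesis by (simp add: encode_list_def enc_list_def encode_nat_def enc_nat_def)
qed

lemma poly_time_nat_bits [poly_time_intros]: "poly_time f \<Longrightarrow> poly_time (\<lambda>x. nat_bits (f x))"
  by (simp add: poly_time_def encode_nat_bits)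

lemma poly_time_of_nat_bits: "poly_time (\<lambda>x. nat_bits (f x)) \<Longrightarrow> poly_time f"
  by (simp add: poly_time_def encode_nat_bits)

definition bitlen :: "nat \<Rightarrow> nat" where
  "bitlen n = length (nat_bits n)"

lemma length_encode_nat: "length (encode n) = bitlen n + 2"
proof -
  have "length (concat (map encode bs)) = length bs" for bs :: "bool list"
    by (induction bs) (auto simp: encode_bool_def)
  then show ?thesis
    unfolding encode_nat_bits[symmetric] bitlen_def by (simp add: encode_list_def enc_list_def)
qed

lemma lsb_val_less: "lsb_val bs < 2 ^ length bs"
  by (induction bs) auto

lemma less_bitlen: "n < 2 ^ bitlen n"
  using lsb_val_less[of "nat_bits n"] by (simp add: lsb_val_nat_bits bitlen_def)

lemma bitlen_le: "n < 2 ^ k \<Longrightarrow> bitlen n \<le> k"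
proof (induction k arbitrary: n)
  case (Suc k)
  then have "n div 2 < 2 ^ k" by auto
  from Suc.IH[OF this] show ?case
    by (cases "n = 0") (simp_all add: bitlen_def nat_bits.simps[of n])
qed (simp add: bitlen_def nat_bits_0)

lemma bitlen_add: "bitlen (m + n) \<le> max (bitlen m) (bitlen n) + 1"
proof (rule bitlen_le)
  have "m < 2 ^ max (bitlen m) (bitlen n)" "n < 2 ^ max (bitlen m) (bitlen n)"
    by (rule less_le_trans[OF less_bitlen], simp)+
  then show "m + n < 2 ^ (max (bitlen m) (bitlen n) + 1)" by simp
qed

lemma bitlen_mult: "bitlen (m * n) \<le> bitlen m + bitlen n"
  by (rule bitlen_le) (simp add: power_add mult_strict_mono less_bitlen)

text \<open>A digit list may have zeros at its most significant end, which the encoding of a number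
  forbids. The fold starts at that end and drops them.\<close>

lemma poly_time_lsb_val [poly_time_intros]:
  assumes "poly_time f" shows "poly_time (\<lambda>x. lsb_val (f x))"
proof (rule poly_time_of_nat_bits)
  define F where "F = (\<lambda>b acc. if acc = [] \<and> \<not> b then [] else b # (acc :: bool list))"
  have "poly_time (\<lambda>e. fold F (rev (f e)) [])"
    by (rule poly_time_fold_length[where q = "[:1:]"])
      (auto simp: F_def encode_list_def enc_list_def encode_bool_def intro!: poly_time_intros assms)
  moreover have "fold F (rev xs) [] = nat_bits (lsb_val xs)" for xs
    by (induction xs) (simp_all add: F_def nat_bits_double nat_bits_0)
  ultimately show "poly_time (\<lambda>x. nat_bits (lsb_val (f x)))" by simp
qed

text \<open>The state consists of the carry, the remaining digits of the second summand and the output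
  digits in reverse order. When the first summand is exhausted, \<open>carry_digit\<close> takes over.\<close>

definition add_digit :: "bool \<Rightarrow> bool \<times> bool list \<times> bool list \<Rightarrow> bool \<times> bool list \<times> bool list" where
  "add_digit x s = (let c = fst s; y = (fst (snd s) \<noteq> [] \<and> hd (fst (snd s))) in
     ((x \<and> y) \<or> (c \<and> (x \<or> y)), tl (fst (snd s)), (x = (y = c)) # snd (snd s)))"

definition carry_digit :: "bool \<Rightarrow> bool \<times> bool list \<Rightarrow> bool \<times> bool list" where
  "carry_digit y s = (fst s \<and> y, (fst s \<noteq> y) # snd s)"

definition add_bits :: "bool list \<Rightarrow> bool list \<Rightarrow> bool list" where
  "add_bits xs ys = (let s = fold add_digit xs (False, ys, []);
     t = fold carry_digit (fst (snd s)) (fst s, snd (snd s)) in rev (fst t # snd t))"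

text \<open>The invariant of schoolbook addition: the digits written so far, plus the carry and the
  unread digits at the current place value, have a constant total.\<close>

lemma fold_add_digit:
  "fold add_digit xs (c, ys, out) = (c', ys', out') \<Longrightarrow>
   lsb_val (rev out') + 2 ^ length out' * (of_bool c' + lsb_val ys') =
   lsb_val (rev out) + 2 ^ length out * (of_bool c + lsb_val xs + lsb_val ys)"
proof (induction xs arbitrary: c ys out)
  case (Cons x xs)
  define y where "y = (ys \<noteq> [] \<and> hd ys)"
  have ys: "lsb_val ys = of_bool y + 2 * lsb_val (tl ys)" by (cases ys) (auto simp: y_def)
  have "add_digit x (c, ys, out) = ((x \<and> y) \<or> (c \<and> (x \<or> y)), tl ys, (x = (y = c)) # out)"
    by (simp add: add_digit_def Let_def y_def)
  with Cons.prems have "fold add_digit xs ((x \<and> y) \<or> (c \<and> (x \<or> y)), tl ys, (x = (y = c)) # out) = (c', ys', out')"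
    by simp
  from Cons.IH[OF this] show ?case
    unfolding ys by (cases x; cases y; cases c) (simp_all add: lsb_val_append algebra_simps)
qed simp

lemma fold_carry_digit:
  "fold carry_digit ys (c, out) = (c', out') \<Longrightarrow>
   lsb_val (rev out') + 2 ^ length out' * of_bool c' =
   lsb_val (rev out) + 2 ^ length out * (of_bool c + lsb_val ys)"
proof (induction ys arbitrary: c out)
  case (Cons y ys)
  have "carry_digit y (c, out) = (c \<and> y, (c \<noteq> y) # out)" by (simp add: carry_digit_def)
  with Cons.prems have "fold carry_digit ys (c \<and> y, (c \<noteq> y) # out) = (c', out')" by simp
  from Cons.IH[OF this] show ?case
    by (cases y; cases c) (simp_all add: lsb_val_append algebra_simps)
qed simp

lemma lsb_val_add_bits: "lsb_val (add_bits xs ys) = lsb_val xs + lsb_val ys"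
proof -
  obtain c1 ys1 out1 where 1: "fold add_digit xs (False, ys, []) = (c1, ys1, out1)" by (metis prod.exhaust)
  obtain c2 out2 where 2: "fold carry_digit ys1 (c1, out1) = (c2, out2)" by fastforce
  from fold_add_digit[OF 1] fold_carry_digit[OF 2] show ?thesis
    by (simp add: add_bits_def Let_def 1 2 lsb_val_append)
qed

lemma poly_time_add_bits:
  assumes "poly_time f" "poly_time g"
  shows "poly_time (\<lambda>x. add_bits (f x) (g x))"
proof -
  have a: "poly_time (\<lambda>e. fold add_digit (f e) (False, g e, []))"
  proof (rule poly_time_fold_length[where q = "[:1:]"])
    show "poly_time (\<lambda>z :: 'a \<times> bool \<times> bool \<times> bool list \<times> bool list. add_digit (fst (snd z)) (snd (snd z)))"
      unfolding add_digit_def Let_def by (intro poly_time_intros)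
    show "length (encode (add_digit x b)) \<le> length (encode b) + poly [:1:] (length (encode e) + length (encode x))"
      for x b and e :: 'a
      by (cases "fst (snd b)") (auto simp: add_digit_def Let_def encode_prod_def encode_bool_def encode_list_def enc_list_def)
  qed (intro poly_time_intros assms)+
  have "poly_time (\<lambda>e. fold carry_digit (fst (snd (fold add_digit (f e) (False, g e, []))))
     (fst (fold add_digit (f e) (False, g e, [])), snd (snd (fold add_digit (f e) (False, g e, [])))))"
  proof (rule poly_time_fold_length[where q = "[:1:]"])
    show "poly_time (\<lambda>z :: 'a \<times> bool \<times> bool \<times> bool list. carry_digit (fst (snd z)) (snd (snd z)))"
      unfolding carry_digit_def by (intro poly_time_intros)
    show "length (encode (carry_digit x b)) \<le> length (encode b) + poly [:1:] (length (encode e) + length (encode x))"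
      for x b and e :: 'a
      by (auto simp: carry_digit_def encode_prod_def encode_bool_def encode_list_def enc_list_def)
  qed (intro poly_time_intros a)+
  then show ?thesis unfolding add_bits_def Let_def by (intro poly_time_intros)
qed

lemma poly_time_add [poly_time_intros]:
  assumes "poly_time f" "poly_time g"
  shows "poly_time (\<lambda>x. f x + (g x :: nat))"
proof -
  have "poly_time (\<lambda>x. lsb_val (add_bits (nat_bits (f x)) (nat_bits (g x))))"
    by (intro poly_time_intros poly_time_add_bits assms)
  then show ?thesis by (simp add: lsb_val_add_bits lsb_val_nat_bits)
qed

text \<open>Horner's scheme, doubling and adding from the most significant digit. The growth bound
  per digit is crude, but it does not involve the accumulator.\<close>

lemma poly_time_mult [poly_time_intros]:
  assumes "poly_time f" "poly_time g"
  shows "poly_time (\<lambda>x. f x * (g x :: nat))"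
proof -
  define F :: "nat \<times> nat \<Rightarrow> bool \<Rightarrow> nat \<Rightarrow> nat" where "F = (\<lambda>e b acc. acc + acc + (if b then snd e else 0))"
  have "poly_time (\<lambda>e :: nat \<times> nat. fold (F e) (rev (nat_bits (fst e))) 0)"
  proof (rule poly_time_fold_length[where q = "[:2, 1:]"])
    show "poly_time (\<lambda>z. F (fst z) (fst (snd z)) (snd (snd z)))"
      unfolding F_def by (intro poly_time_intros)
    fix e b acc
    have "bitlen (F e b acc) \<le> bitlen acc + bitlen (snd e) + 2"
      using bitlen_add[of "acc + acc" "if b then snd e else 0"] bitlen_add[of acc acc]
      by (auto simp: F_def bitlen_def nat_bits_0 split: if_splits)
    then show "length (encode (F e b acc)) \<le> length (encode acc) + poly [:2, 1:] (length (encode e) + length (encode b))"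
      by (simp add: length_encode_nat encode_prod_def)
  qed (intro poly_time_intros)+
  moreover have "fold (F e) (rev bs) 0 = lsb_val bs * snd e" for e bs
    by (induction bs) (auto simp: F_def algebra_simps)
  ultimately have "poly_time (\<lambda>e :: nat \<times> nat. fst e * snd e)" by (simp add: lsb_val_nat_bits)
  from poly_time_comp[OF this poly_time_Pair[OF assms]] show ?thesis by simp
qed

lemma poly_time_length [poly_time_intros]:
  fixes f :: "'a :: encodable \<Rightarrow> 'b :: encodable list"
  assumes "poly_time f" shows "poly_time (\<lambda>x. length (f x))"
proof -
  have "poly_time (\<lambda>e. fold (\<lambda>x n. n + 1) (f e) (0 :: nat))"
  proof (rule poly_time_fold_length[where q = "[:2:]"])
    \<comment> \<open>The constant 2 comes from \<open>bitlen_add\<close>, whose maximum with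
      \<open>bitlen 1\<close> matters when the counter is still 0.\<close>
    have "bitlen 1 = 1" by (simp add: bitlen_def nat_bits.simps[of "Suc 0"] nat_bits_0)
    then show "length (encode (n + 1)) \<le> length (encode n) + poly [:2:] (length (encode e) + length (encode x))" 
      for n :: nat and e :: 'a and x :: 'b
      using bitlen_add[of n 1] by (simp add: length_encode_nat)
  qed (intro poly_time_intros assms)+
  moreover have "fold (\<lambda>x n. n + 1) xs k = length xs + k" for xs :: "'b list" and k :: nat
    by (induction xs arbitrary: k) auto
  ultimately show ?thesis by simp
qed

text \<open>The flag is the verdict on the digits read so far. As they come in ascending
  significance, a later difference overrides it. Digits of the second number that are left over
  decide in its favour if one of them is nonzero.\<close>

definition compare_digit :: "bool \<Rightarrow> bool \<times> bool list \<Rightarrow> bool \<times> bool list" where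
  "compare_digit x s = (let y = (snd s \<noteq> [] \<and> hd (snd s)) in
     (if x = y then fst s else y, tl (snd s)))"

lemma fold_compare_digit:
  "fold compare_digit xs (r, ys) = (r', ys') \<Longrightarrow>
   (r' \<or> lsb_val ys' > 0) \<longleftrightarrow> (lsb_val xs < lsb_val ys \<or> lsb_val xs = lsb_val ys \<and> r)"
proof (induction xs arbitrary: r ys)
  case (Cons x xs)
  define y where "y = (ys \<noteq> [] \<and> hd ys)"
  have ys: "lsb_val ys = of_bool y + 2 * lsb_val (tl ys)" by (cases ys) (auto simp: y_def)
  have "compare_digit x (r, ys) = (if x = y then r else y, tl ys)"
    by (simp only: compare_digit_def Let_def y_def fst_conv snd_conv)
  with Cons.prems have "fold compare_digit xs (if x = y then r else y, tl ys) = (r', ys')" by simp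
  from Cons.IH[OF this] show ?case unfolding ys by (cases x; cases y) auto
qed auto

lemma poly_time_le [poly_time_intros]:
  assumes "poly_time f" "poly_time g"
  shows "poly_time (\<lambda>x. f x \<le> (g x :: nat))"
proof -
  let ?s = "\<lambda>e. fold compare_digit (nat_bits (f e)) (True, nat_bits (g e))"
  have a: "poly_time ?s"
  proof (rule poly_time_fold_length[where q = "[:1:]"])
    show "poly_time (\<lambda>z :: 'a \<times> bool \<times> bool \<times> bool list. compare_digit (fst (snd z)) (snd (snd z)))"
      unfolding compare_digit_def Let_def by (intro poly_time_intros)
    show "length (encode (compare_digit x b)) \<le> length (encode b) + poly [:1:] (length (encode e) + length (encode x))"
      for x b and e :: 'a
      by (cases "snd b") (auto simp: compare_digit_def Let_def encode_prod_def encode_bool_def encode_list_def enc_list_def)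
  qed (intro poly_time_intros assms)+
  have "poly_time (\<lambda>e. fold (\<lambda>y r. r \<or> y) (snd (?s e)) (fst (?s e)))"
    by (rule poly_time_fold_length[where q = "[:1:]"])
      (auto intro!: poly_time_intros a simp: encode_bool_def)
  moreover have "fold (\<lambda>y r. r \<or> y) ys r \<longleftrightarrow> r \<or> lsb_val ys > 0" for ys r
    by (induction ys arbitrary: r) auto
  moreover have "fst (?s e) \<or> lsb_val (snd (?s e)) > 0 \<longleftrightarrow> f e \<le> g e" for e
    using fold_compare_digit[of "nat_bits (f e)" True "nat_bits (g e)" "fst (?s e)" "snd (?s e)"]
    by (auto simp: lsb_val_nat_bits)
  ultimately show ?thesis by simp
qed


section \<open>Fractions and transport costs\<close>

text \<open>Shaped to have literally the encoding of the rational: the sign symbol is the first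
  entry in the block of the numerator, so it becomes the first digit of the list.\<close>

definition rat_parts :: "rat \<Rightarrow> bool list \<times> nat" where
  "rat_parts x = ((fst (quotient_of x) < 0) # nat_bits (nat \<bar>fst (quotient_of x)\<bar>), nat (snd (quotient_of x)))"

lemma encode_rat_parts: "encode (rat_parts x) = encode x"
proof -
  have "tl (encode (nat_bits n)) = bits n @ [Close]" for n
    by (simp add: encode_nat_bits encode_nat_def enc_nat_def)
  then show ?thesis
    by (auto simp: rat_parts_def encode_prod_def encode_list_simps(2) encode_rat_def enc_rat_def enc_int_def
        encode_nat_def encode_bool_def split: prod.splits)
qed

lemma poly_time_rat_parts [poly_time_intros]: "poly_time f \<Longrightarrow> poly_time (\<lambda>x. rat_parts (f x))"
  by (simp add: poly_time_def encode_rat_parts)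

text \<open>The triple \<open>(p, n, b)\<close> stands for the unreduced fraction \<open>(p - n) / b\<close>.\<close>

type_synonym frac = "nat \<times> nat \<times> nat"

text \<open>With the numerator as a difference, signed arithmetic needs only sums and products of
  naturals: negation swaps two components, and a comparison moves the subtracted parts to the other
  side.\<close>

definition frac_val :: "frac \<Rightarrow> real" where
  "frac_val f = (real (fst f) - real (fst (snd f))) / real (snd (snd f))"

definition proper_frac :: "frac \<Rightarrow> bool" where
  "proper_frac f \<longleftrightarrow> 0 < snd (snd f)"

definition frac_of_rat :: "rat \<Rightarrow> frac" where
  "frac_of_rat x = (if hd (fst (rat_parts x)) then (0, lsb_val (tl (fst (rat_parts x))), snd (rat_parts x))
     else (lsb_val (tl (fst (rat_parts x))), 0, snd (rat_parts x)))"

definition add_frac :: "frac \<Rightarrow> frac \<Rightarrow> frac" where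
  "add_frac f g = (fst f * snd (snd g) + fst g * snd (snd f),
     fst (snd f) * snd (snd g) + fst (snd g) * snd (snd f), snd (snd f) * snd (snd g))"

definition mult_frac :: "frac \<Rightarrow> frac \<Rightarrow> frac" where
  "mult_frac f g = (fst f * fst g + fst (snd f) * fst (snd g),
     fst f * fst (snd g) + fst (snd f) * fst g, snd (snd f) * snd (snd g))"

definition neg_frac :: "frac \<Rightarrow> frac" where
  "neg_frac f = (fst (snd f), fst f, snd (snd f))"

definition le_frac :: "frac \<Rightarrow> frac \<Rightarrow> bool" where
  "le_frac f g \<longleftrightarrow> fst f * snd (snd g) + fst (snd g) * snd (snd f) \<le> fst g * snd (snd f) + fst (snd f) * snd (snd g)"

definition sum_frac :: "frac list \<Rightarrow> frac" where
  "sum_frac fs = fold add_frac fs (0, 0, 1)"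

lemma frac_of_rat: "proper_frac (frac_of_rat x)" "frac_val (frac_of_rat x) = of_rat x"
proof -
  obtain a b where q: "quotient_of x = (a, b)" by fastforce
  have b: "b > 0" using quotient_of_denom_pos[OF q] .
  have "(of_rat x :: real) = of_int a / of_int b"
    using quotient_of_div[OF q] by (simp add: of_rat_divide)
  with b show "proper_frac (frac_of_rat x)" "frac_val (frac_of_rat x) = of_rat x"
    by (auto simp: frac_of_rat_def rat_parts_def q lsb_val_nat_bits frac_val_def proper_frac_def)
qed

lemma add_frac:
  assumes "proper_frac f" "proper_frac g"
  shows "proper_frac (add_frac f g)" "frac_val (add_frac f g) = frac_val f + frac_val g"
  using assms by (auto simp: proper_frac_def frac_val_def add_frac_def field_simps)

lemma mult_frac:
  assumes "proper_frac f" "proper_frac g"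
  shows "proper_frac (mult_frac f g)" "frac_val (mult_frac f g) = frac_val f * frac_val g"
  using assms by (auto simp: proper_frac_def frac_val_def mult_frac_def field_simps)

lemma neg_frac:
  assumes "proper_frac f"
  shows "proper_frac (neg_frac f)" "frac_val (neg_frac f) = - frac_val f"
  using assms by (auto simp: proper_frac_def frac_val_def neg_frac_def field_simps)

lemma le_frac:
  assumes "proper_frac f" "proper_frac g"
  shows "le_frac f g \<longleftrightarrow> frac_val f \<le> frac_val g"
proof -
  have "le_frac f g \<longleftrightarrow> real (fst f * snd (snd g) + fst (snd g) * snd (snd f)) \<le>
      real (fst g * snd (snd f) + fst (snd f) * snd (snd g))"
    unfolding le_frac_def of_nat_le_iff ..
  then show ?thesis using assms by (simp add: proper_frac_def frac_val_def field_simps)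
qed

lemma sum_frac:
  assumes "\<And>x. x \<in> set xs \<Longrightarrow> proper_frac (h x)"
  shows "proper_frac (sum_frac (map h xs))" "frac_val (sum_frac (map h xs)) = (\<Sum>x\<leftarrow>xs. frac_val (h x))"
proof -
  have "proper_frac (fold add_frac (map h xs) f) \<and>
    frac_val (fold add_frac (map h xs) f) = frac_val f + (\<Sum>x\<leftarrow>xs. frac_val (h x))" if "proper_frac f" for f
    using assms that
  proof (induction xs arbitrary: f)
    case (Cons x xs)
    then show ?case by (simp add: add_frac)
  qed simp
  from this[of "(0, 0, 1)"]
  show "proper_frac (sum_frac (map h xs))" "frac_val (sum_frac (map h xs)) = (\<Sum>x\<leftarrow>xs. frac_val (h x))"
    by (auto simp: sum_frac_def proper_frac_def frac_val_def)
qed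

section \<open>Fraction arithmetic in polynomial time\<close>

lemma poly_time_frac_of_rat [poly_time_intros]: "poly_time f \<Longrightarrow> poly_time (\<lambda>x. frac_of_rat (f x))"
  unfolding frac_of_rat_def by (intro poly_time_intros)

lemma poly_time_add_frac [poly_time_intros]:
  "poly_time f \<Longrightarrow> poly_time g \<Longrightarrow> poly_time (\<lambda>x. add_frac (f x) (g x))"
  unfolding add_frac_def by (intro poly_time_intros)

lemma poly_time_mult_frac [poly_time_intros]:
  "poly_time f \<Longrightarrow> poly_time g \<Longrightarrow> poly_time (\<lambda>x. mult_frac (f x) (g x))"
  unfolding mult_frac_def by (intro poly_time_intros)

lemma poly_time_neg_frac [poly_time_intros]: "poly_time f \<Longrightarrow> poly_time (\<lambda>x. neg_frac (f x))"
  unfolding neg_frac_def by (intro poly_time_intros)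

lemma poly_time_le_frac [poly_time_intros]:
  "poly_time f \<Longrightarrow> poly_time g \<Longrightarrow> poly_time (\<lambda>x. le_frac (f x) (g x))"
  unfolding le_frac_def by (intro poly_time_intros)

text \<open>The maximal bit length grows additively under addition of fractions; the encoding length
  of the triple does not.\<close>

lemma poly_time_sum_frac [poly_time_intros]:
  fixes f :: "'a :: encodable \<Rightarrow> frac list"
  assumes "poly_time f"
  shows "poly_time (\<lambda>x. sum_frac (f x))"
  unfolding sum_frac_def
\<comment> \<open>In \<open>[:6, 3:]\<close> three numbers are counted, each with two delimiters.
  The polynomial \<open>[:1, 1:]\<close> stands for the size of the new summand and the carry of one
  addition.\<close>
proof (rule poly_time_fold[where r = "[:6, 3:]" and q = "[:1, 1:]" and
      \<mu> = "\<lambda>f. max (bitlen (fst f)) (max (bitlen (fst (snd f))) (bitlen (snd (snd f))))"])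
  let ?\<mu> = "\<lambda>f :: frac. max (bitlen (fst f)) (max (bitlen (fst (snd f))) (bitlen (snd (snd f))))"
  show "poly_time (\<lambda>z :: 'a \<times> frac \<times> frac. add_frac (fst (snd z)) (snd (snd z)))"
    by (intro poly_time_intros)
  have prod: "bitlen (a * b) \<le> i + j" if "bitlen a \<le> i" "bitlen b \<le> j" for a b i j
    using bitlen_mult[of a b] that by linarith
  have sum: "bitlen (a * b + a' * b') \<le> i + j + 1"
    if "bitlen a \<le> i" "bitlen b \<le> j" "bitlen a' \<le> j" "bitlen b' \<le> i" for a b a' b' i j
    using bitlen_add[of "a * b" "a' * b'"] prod[OF that(1,2)] prod[OF that(4,3)] by (simp add: mult.commute)
  show "?\<mu> (add_frac x b) \<le> ?\<mu> b + poly [:1, 1:] (length (encode e) + length (encode x))" for e :: 'a and x b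
  proof -
    have le: "bitlen (fst f) \<le> ?\<mu> f" "bitlen (fst (snd f)) \<le> ?\<mu> f" "bitlen (snd (snd f)) \<le> ?\<mu> f" for f
      by simp_all
    have "?\<mu> (add_frac x b) \<le> ?\<mu> x + ?\<mu> b + 1"
      unfolding add_frac_def fst_conv snd_conv
      by (intro max.boundedI sum le trans_le_add1[OF prod])
    moreover have "?\<mu> x \<le> length (encode x)" by (simp add: encode_prod_def length_encode_nat)
    moreover have "i \<le> j + poly [:1, 1:] (k + l)" if "i \<le> h + j + 1" "h \<le> l" for h i j k l :: nat
      using that by simp
    ultimately show ?thesis by blast
  qed
  show "?\<mu> b \<le> length (encode b)" "length (encode b) \<le> poly [:6, 3:] (?\<mu> b)" for b
    by (simp_all add: encode_prod_def length_encode_nat)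
qed (intro poly_time_intros assms)+

section \<open>Transport costs as fractions\<close>

definition dist_frac :: "point \<Rightarrow> point \<Rightarrow> frac" where
  "dist_frac x y = sum_frac (map (\<lambda>z. mult_frac
     (add_frac (frac_of_rat (fst z)) (neg_frac (frac_of_rat (snd z))))
     (add_frac (frac_of_rat (fst z)) (neg_frac (frac_of_rat (snd z))))) (zip x y))"

text \<open>Twice the cost of the tuple. The sum runs over ordered pairs, whose diagonal
  vanishes.\<close>

definition tuple_frac :: "rat list \<Rightarrow> point list \<Rightarrow> frac" where
  "tuple_frac lam s = sum_frac (map (\<lambda>u. sum_frac (map (\<lambda>v.
     mult_frac (mult_frac (frac_of_rat (fst u)) (frac_of_rat (fst v))) (dist_frac (snd u) (snd v)))
     (zip lam s))) (zip lam s))"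

definition cost_frac :: "rat list \<Rightarrow> comb \<Rightarrow> frac" where
  "cost_frac lam Q = sum_frac (map (\<lambda>z. mult_frac (tuple_frac lam (fst z)) (frac_of_rat (snd z))) Q)"

lemma poly_time_dist_frac [poly_time_intros]:
  "poly_time f \<Longrightarrow> poly_time g \<Longrightarrow> poly_time (\<lambda>x. dist_frac (f x) (g x))"
  unfolding dist_frac_def by (intro poly_time_intros poly_time_map)

lemma poly_time_tuple_frac [poly_time_intros]:
  assumes "poly_time f" "poly_time g"
  shows "poly_time (\<lambda>x. tuple_frac (f x) (g x))"
  unfolding tuple_frac_def
  by (intro poly_time_intros poly_time_map assms poly_time_comp[OF assms(1)] poly_time_comp[OF assms(2)])

lemma poly_time_cost_frac [poly_time_intros]:
  assumes "poly_time f" "poly_time g"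
  shows "poly_time (\<lambda>x. cost_frac (f x) (g x))"
  unfolding cost_frac_def
  by (intro poly_time_intros poly_time_map assms poly_time_comp[OF assms(1)])

lemma sum_list_zip:
  fixes h :: "'a \<times> 'b \<Rightarrow> real"
  assumes "length xs = n" "length ys = n"
  shows "(\<Sum>z\<leftarrow>zip xs ys. h z) = (\<Sum>i<n. h (xs ! i, ys ! i))"
  using assms by (simp add: sum_list_sum_nth atLeast0LessThan)

lemma dist_frac:
  assumes "length x = d" "length y = d"
  shows "proper_frac (dist_frac x y)" "frac_val (dist_frac x y) = (\<Sum>k<d. (of_rat (x ! k) - of_rat (y ! k))\<^sup>2)"
  unfolding dist_frac_def using assms
  by (simp_all add: sum_frac mult_frac add_frac neg_frac frac_of_rat sum_list_zip power2_eq_square)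

lemma tuple_frac:
  assumes "length lam = m" "length s = m" "\<And>i. i < m \<Longrightarrow> length (s ! i) = d"
  shows "proper_frac (tuple_frac lam s)"
    "frac_val (tuple_frac lam s) = (\<Sum>i<m. \<Sum>j<m. of_rat (lam ! i) * of_rat (lam ! j) *
       (\<Sum>k<d. (of_rat (s ! i ! k) - of_rat (s ! j ! k))\<^sup>2))"
proof -
  have len: "length (snd u) = d" if "u \<in> set (zip lam s)" for u
    using that assms by (auto simp: set_zip)
  let ?h = "\<lambda>u v. mult_frac (mult_frac (frac_of_rat (fst u)) (frac_of_rat (fst v))) (dist_frac (snd u) (snd v))"
  have h: "proper_frac (?h u v)" "frac_val (?h u v) = of_rat (fst u) * of_rat (fst v) *
      (\<Sum>k<d. (of_rat (snd u ! k) - of_rat (snd v ! k))\<^sup>2)"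
    if "u \<in> set (zip lam s)" "v \<in> set (zip lam s)" for u v
    using len[OF that(1)] len[OF that(2)] by (simp_all add: mult_frac frac_of_rat dist_frac)
  have inner: "proper_frac (sum_frac (map (?h u) (zip lam s)))"
    "frac_val (sum_frac (map (?h u) (zip lam s))) = (\<Sum>v\<leftarrow>zip lam s. frac_val (?h u v))"
    if "u \<in> set (zip lam s)" for u
    using sum_frac[of "zip lam s" "?h u"] h(1)[OF that] by blast+
  show "proper_frac (tuple_frac lam s)"
    unfolding tuple_frac_def by (rule sum_frac(1)) (rule inner(1))
  have "frac_val (tuple_frac lam s) = (\<Sum>u\<leftarrow>zip lam s. frac_val (sum_frac (map (?h u) (zip lam s))))"
    unfolding tuple_frac_def by (rule sum_frac(2)) (rule inner(1))
  also have "\<dots> = (\<Sum>u\<leftarrow>zip lam s. \<Sum>v\<leftarrow>zip lam s. of_rat (fst u) * of_rat (fst v) *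
      (\<Sum>k<d. (of_rat (snd u ! k) - of_rat (snd v ! k))\<^sup>2))"
  proof (intro arg_cong[of _ _ sum_list] map_cong refl)
    fix u assume u: "u \<in> set (zip lam s)"
    show "frac_val (sum_frac (map (?h u) (zip lam s))) = (\<Sum>v\<leftarrow>zip lam s. of_rat (fst u) * of_rat (fst v) *
      (\<Sum>k<d. (of_rat (snd u ! k) - of_rat (snd v ! k))\<^sup>2))"
      unfolding inner(2)[OF u] by (intro arg_cong[of _ _ sum_list] map_cong refl h(2) u)
  qed
  finally show "frac_val (tuple_frac lam s) = (\<Sum>i<m. \<Sum>j<m. of_rat (lam ! i) * of_rat (lam ! j) *
       (\<Sum>k<d. (of_rat (s ! i ! k) - of_rat (s ! j ! k))\<^sup>2))"
    by (simp add: sum_list_zip[OF assms(1,2)])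
qed

text \<open>The weighted variance as a sum over pairs, which avoids computing the mean.\<close>

lemma weighted_variance_pairs:
  fixes a x :: "nat \<Rightarrow> real"
  assumes "(\<Sum>i<m. a i) = 1"
  shows "2 * (\<Sum>i<m. a i * ((\<Sum>j<m. a j * x j) - x i)\<^sup>2) = (\<Sum>i<m. \<Sum>j<m. a i * a j * (x i - x j)\<^sup>2)"
proof -
  define \<mu> where "\<mu> = (\<Sum>j<m. a j * x j)"
  \<comment> \<open>Both sides are expressed by the mean \<mu> and the second moment
    \<open>q\<close>: the single sum is \<open>q - \<mu>\<^sup>2\<close> and the double sum is twice
    that.\<close>
  define q where "q = (\<Sum>i<m. a i * (x i)\<^sup>2)"
  have "(\<Sum>i<m. a i * (\<mu> - x i)\<^sup>2) = (\<Sum>i<m. \<mu>\<^sup>2 * a i - 2 * \<mu> * (a i * x i) + a i * (x i)\<^sup>2)"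
    by (intro sum.cong) (auto simp: power2_diff algebra_simps)
  also have "\<dots> = q - \<mu>\<^sup>2"
    unfolding sum.distrib sum_subtractf sum_distrib_left[symmetric] assms
    by (simp add: q_def[symmetric] \<mu>_def[symmetric]) (simp add: power2_eq_square)
  finally have 1: "(\<Sum>i<m. a i * (\<mu> - x i)\<^sup>2) = q - \<mu>\<^sup>2" .
  have "(\<Sum>j<m. a i * a j * (x i - x j)\<^sup>2) = a i * (x i)\<^sup>2 - 2 * \<mu> * (a i * x i) + a i * q" for i
  proof -
    have "(\<Sum>j<m. a i * a j * (x i - x j)\<^sup>2) =
        (\<Sum>j<m. a i * (x i)\<^sup>2 * a j - 2 * (a i * x i) * (a j * x j) + a i * (a j * (x j)\<^sup>2))"
      by (intro sum.cong) (auto simp: power2_diff algebra_simps)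
    also have "\<dots> = a i * (x i)\<^sup>2 - 2 * \<mu> * (a i * x i) + a i * q"
      unfolding sum.distrib sum_subtractf sum_distrib_left[symmetric] assms
      by (simp add: q_def[symmetric] \<mu>_def[symmetric])
    finally show ?thesis .
  qed
  then have "(\<Sum>i<m. \<Sum>j<m. a i * a j * (x i - x j)\<^sup>2) =
      (\<Sum>i<m. a i * (x i)\<^sup>2 - 2 * \<mu> * (a i * x i) + a i * q)" by simp
  also have "\<dots> = q - 2 * \<mu> * \<mu> + q"
    unfolding sum.distrib sum_subtractf sum_distrib_left[symmetric] sum_distrib_right[symmetric] assms
    by (simp add: q_def[symmetric] \<mu>_def[symmetric])
  finally show ?thesis using 1 by (simp add: \<mu>_def power2_eq_square)
qed

text \<open>The squared norm splits into coordinates. For each coordinate the variance identity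
  applies with the same weights, and the summations are then interchanged.\<close>

lemma tuple_cost_pairs:
  assumes "length lam = m" "sum_list lam = 1"
  shows "2 * tuple_cost d lam s = (\<Sum>i<m. \<Sum>j<m. of_rat (lam ! i) * of_rat (lam ! j) *
     (\<Sum>k<d. (of_rat (s ! i ! k) - of_rat (s ! j ! k))\<^sup>2))"
proof -
  let ?a = "\<lambda>i. of_rat (lam ! i) :: real" and ?x = "\<lambda>k i. of_rat (s ! i ! k) :: real"
  have "(\<Sum>i<m. ?a i) = of_rat (sum_list lam)"
    using assms(1) by (simp add: sum_list_sum_nth atLeast0LessThan of_rat_sum)
  then have one: "(\<Sum>i<m. ?a i) = 1" using assms(2) by simp
  have "(euclidean_dist d (weighted_mean d lam s) (s ! i))\<^sup>2 = (\<Sum>k<d. ((\<Sum>j<m. ?a j * ?x k j) - ?x k i)\<^sup>2)" for i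
    using assms(1)
    by (simp add: euclidean_dist_def L2_set_def sum_nonneg weighted_mean_def of_rat_sum of_rat_mult)
  then have "2 * tuple_cost d lam s = 2 * (\<Sum>i<m. ?a i * (\<Sum>k<d. ((\<Sum>j<m. ?a j * ?x k j) - ?x k i)\<^sup>2))"
    using assms(1) by (simp add: tuple_cost_def)
  also have "\<dots> = (\<Sum>k<d. 2 * (\<Sum>i<m. ?a i * ((\<Sum>j<m. ?a j * ?x k j) - ?x k i)\<^sup>2))"
    unfolding sum_distrib_left by (rule sum.swap)
  also have "\<dots> = (\<Sum>k<d. \<Sum>i<m. \<Sum>j<m. ?a i * ?a j * (?x k i - ?x k j)\<^sup>2)"
    by (simp only: weighted_variance_pairs[OF one])
  also have "\<dots> = (\<Sum>i<m. \<Sum>k<d. \<Sum>j<m. ?a i * ?a j * (?x k i - ?x k j)\<^sup>2)"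
    by (rule sum.swap)
  also have "\<dots> = (\<Sum>i<m. \<Sum>j<m. \<Sum>k<d. ?a i * ?a j * (?x k i - ?x k j)\<^sup>2)"
    by (intro sum.cong refl sum.swap)
  finally show ?thesis by (simp add: sum_distrib_left)
qed

text \<open>Every tuple of a combination measure consists of one support point per measure, all of
  dimension \<open>d\<close>. Hence no \<open>zip\<close> in the computation truncates
  anything.\<close>

lemma cost_frac:
  assumes "scmp_instance d I" "combination_measure (input_measures I) Q"
  shows "proper_frac (cost_frac (weights I) Q)"
    "frac_val (cost_frac (weights I) Q) = 2 * transport_cost d (weights I) Q"
proof -
  let ?m = "length (weights I)"
  have m: "length (input_measures I) = ?m" and w1: "sum_list (weights I) = 1"
    using assms(1) by (auto simp: scmp_instance_def)
  have s: "length s = ?m" "\<And>i. i < ?m \<Longrightarrow> length (s ! i) = d" if "(s, w) \<in> set Q" for s w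
  proof -
    have "s \<in> tuples (input_measures I)" using assms(2) that by (auto simp: combination_measure_def)
    then have t: "length s = ?m" "\<And>i. i < ?m \<Longrightarrow> s ! i \<in> supp (input_measures I ! i)"
      using m by (auto simp: tuples_def)
    show "length s = ?m" by (rule t)
    fix i assume i: "i < ?m"
    then have "discrete_prob_measure d (input_measures I ! i)"
      using assms(1) m by (auto simp: scmp_instance_def)
    with t(2)[OF i] show "length (s ! i) = d"
      by (auto simp: supp_def discrete_prob_measure_def)
  qed
  have z: "proper_frac (mult_frac (tuple_frac (weights I) (fst z)) (frac_of_rat (snd z)))"
    "frac_val (mult_frac (tuple_frac (weights I) (fst z)) (frac_of_rat (snd z))) =
      2 * (tuple_cost d (weights I) (fst z) * of_rat (snd z))" if "z \<in> set Q" for z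
  proof -
    have "(fst z, snd z) \<in> set Q" using that by simp
    note t = tuple_frac[OF refl s(1)[OF this] s(2)[OF this]]
    show "proper_frac (mult_frac (tuple_frac (weights I) (fst z)) (frac_of_rat (snd z)))"
      "frac_val (mult_frac (tuple_frac (weights I) (fst z)) (frac_of_rat (snd z))) =
        2 * (tuple_cost d (weights I) (fst z) * of_rat (snd z))"
      using t tuple_cost_pairs[OF refl w1, of d "fst z"] by (simp_all add: mult_frac frac_of_rat)
  qed
  show "proper_frac (cost_frac (weights I) Q)"
    unfolding cost_frac_def by (rule sum_frac(1)) (rule z(1))
  have "frac_val (cost_frac (weights I) Q) = (\<Sum>z\<leftarrow>Q. 2 * (tuple_cost d (weights I) (fst z) * of_rat (snd z)))"
    unfolding cost_frac_def using z by (subst sum_frac(2)) (auto intro!: arg_cong[of _ _ sum_list])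
  then show "frac_val (cost_frac (weights I) Q) = 2 * transport_cost d (weights I) Q"
    by (simp add: transport_cost_def sum_list_const_mult case_prod_unfold)
qed

text \<open>The components of \<open>z\<close> are the measures, the weights, the size bound, the
  cost bound and the candidate. The cost bound is added to itself because \<open>cost_frac\<close>
  is twice the cost.\<close>

definition verifier :: "dmeasure list \<times> rat list \<times> nat \<times> rat \<times> comb \<Rightarrow> bool" where
  "verifier z \<longleftrightarrow> length (snd (snd (snd (snd z)))) \<le> fst (snd (snd z)) \<and>
     le_frac (cost_frac (fst (snd z)) (snd (snd (snd (snd z)))))
       (add_frac (frac_of_rat (fst (snd (snd (snd z))))) (frac_of_rat (fst (snd (snd (snd z))))))"

lemma poly_time_verifier: "poly_time verifier"
  unfolding verifier_def by (intro poly_time_intros)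

lemma verifier:
  assumes "scmp_instance d I" "combination_measure (input_measures I) Q"
  shows "verifier (input_measures I, weights I, size_bound I, cost_bound I, Q) \<longleftrightarrow>
    support_size Q \<le> size_bound I \<and> transport_cost d (weights I) Q \<le> of_rat (cost_bound I)"
proof -
  have "support_size Q = length Q"
    using assms(2) distinct_card[of "map fst Q"] by (simp add: combination_measure_def support_size_def)
  then show ?thesis
    using cost_frac[OF assms] by (simp add: verifier_def le_frac add_frac frac_of_rat)
qed

lemma encode_input:
  "encode (input_measures I, weights I, size_bound I, cost_bound I, Q) = enc_instance I @ enc_comb Q"
proof -
  have r: "(encode :: rat \<Rightarrow> _) = enc_rat" by (simp add: fun_eq_iff encode_rat_def)
  have p: "(encode :: point \<Rightarrow> _) = enc_point" by (simp add: fun_eq_iff encode_list_def enc_point_def r)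
  have ms: "(encode :: dmeasure \<Rightarrow> _) = enc_measure"
    by (simp add: fun_eq_iff encode_list_def enc_measure_def encode_prod_def[abs_def] p r case_prod_unfold)
  have c: "(encode :: comb \<Rightarrow> _) = enc_comb"
    by (simp add: fun_eq_iff encode_list_def[abs_def] enc_comb_def encode_prod_def[abs_def] p[symmetric] r case_prod_unfold)
  have "(encode :: dmeasure list \<Rightarrow> _) = enc_list enc_measure" "(encode :: rat list \<Rightarrow> _) = enc_list enc_rat"
    by (simp_all add: fun_eq_iff encode_list_def ms r)
  then show ?thesis by (simp add: encode_prod_def c r encode_nat_def enc_instance_def)
qed

lemma decides_within_mono: "decides_within M w t b \<Longrightarrow> t \<le> u \<Longrightarrow> decides_within M w u b"
  unfolding decides_within_def by (meson order_trans)

lemma max_measure_size_le: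
  assumes "scmp_instance d I"
  shows "max_measure_size I \<le> length (enc_instance I)"
proof -
  \<comment> \<open>The empty list of weights would sum to 0 instead of 1. This keeps
    \<open>Max\<close> away from the empty set.\<close>
  have "input_measures I \<noteq> []" using assms by (auto simp: scmp_instance_def)
  moreover have "length (enc_measure P) \<le> length (enc_instance I)" if "P \<in> set (input_measures I)" for P
  proof -
    have "length (enc_measure P) \<le> length (concat (map enc_measure (input_measures I)))"
      using that by (simp add: length_concat member_le_sum_list)
    then show ?thesis by (simp add: enc_instance_def enc_list_def)
  qed
  ultimately show ?thesis unfolding max_measure_size_def by (intro Max.boundedI) auto
qed

theorem theorem7:
  fixes p r :: "nat poly"
  shows "\<exists>(M :: tm) (q :: nat poly). wf_tm M \<and>
    (\<forall>(d :: nat) (I :: scmp) (Q :: comb).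
       scmp_instance d I \<longrightarrow>
       length (enc_instance I) \<le> poly r (total_measure_size I) \<longrightarrow>
       combination_measure (input_measures I) Q \<longrightarrow>
       length (enc_comb Q) \<le> poly p (max_measure_size I) \<longrightarrow>
       decides_within M (enc_instance I @ enc_comb Q)
         (poly q (length (enc_instance I)))
         (support_size Q \<le> size_bound I \<and>
          transport_cost d (weights I) Q \<le> of_rat (cost_bound I)))"
proof -
  \<comment> \<open>Program and machine come from \<open>verifier\<close> alone; the polynomial
    \<open>p\<close> enters only the time bound.\<close>
  obtain c k s where c: "\<And>z \<sigma>. \<sigma> 0 = encode z \<Longrightarrow> (\<And>i. 0 < i \<Longrightarrow> i < k \<Longrightarrow> \<sigma> i = []) \<Longrightarrow>
       runs c \<sigma> (poly s (length (encode z))) (\<sigma>(0 := encode (verifier z)))"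
    using transformsE[OF poly_time_verifier[unfolded poly_time_def]] by metis
  obtain M where M: "wf_tm M" "\<And>w t \<sigma> b. exec c (\<lambda>i. if i = 0 then w else []) t \<sigma> \<Longrightarrow>
      \<sigma> 0 = [if b then One else Zero] \<Longrightarrow> decides_within M w (t + 2) b"
    using machine_of_program[of c] by blast
  show ?thesis
  \<comment> \<open>The whole input has length at most \<open>n + poly p n\<close> for an instance
    of length \<open>n\<close>, and the program runs in time \<open>s\<close> of that. The constant
    2 is the overhead of \<open>machine_of_program\<close>.\<close>
  proof (intro exI[of _ M] exI[of _ "pcompose s ([:0, 1:] + p) + [:2:]"] conjI allI impI M(1))
    fix d I Q
    assume I: "scmp_instance d I" "combination_measure (input_measures I) Q"
      and Q: "length (enc_comb Q) \<le> poly p (max_measure_size I)"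
    let ?z = "(input_measures I, weights I, size_bound I, cost_bound I, Q)"
    let ?w = "enc_instance I @ enc_comb Q"
    let ?n = "length (enc_instance I)"
    obtain t where t: "t \<le> poly s (length ?w)"
      "exec c (\<lambda>i. if i = 0 then ?w else []) t ((\<lambda>i. if i = 0 then ?w else [])(0 := encode (verifier ?z)))"
      using c[of "\<lambda>i. if i = 0 then ?w else []" ?z] unfolding runs_def encode_input by auto
    have "decides_within M ?w (t + 2) (verifier ?z)"
      by (rule M(2)[OF t(2)]) (simp add: encode_bool_def)
    moreover have "length ?w \<le> ?n + poly p ?n"
      using order_trans[OF Q poly_nat_mono[OF max_measure_size_le[OF I(1)]]] by simp
    from order_trans[OF t(1) poly_nat_mono[OF this]]
    have "t + 2 \<le> poly (pcompose s ([:0, 1:] + p) + [:2:]) ?n"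
      by (simp add: poly_pcompose)
    ultimately show "decides_within M ?w (poly (pcompose s ([:0, 1:] + p) + [:2:]) ?n)
         (support_size Q \<le> size_bound I \<and> transport_cost d (weights I) Q \<le> of_rat (cost_bound I))"
      unfolding verifier[OF I] by (rule decides_within_mono)
  qed
qed

end
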